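(* Let $\mathcal{H}$ be a separable infinite dimensional complex Hilbert space and let $\Phi:\mathcal{B}(\mathcal{H})\to\mathcal{B}(\mathcal{H})$ be a linear map. Then $\Phi$ preserves the extreme points of the unit ball of $\mathcal{B}(\mathcal{H})$ if and only if at least one of the following holds: (i) there are a unitary operator $V$ on $\mathcal{H}$ and a collection $\{U_\alpha\}$ of isometries on $\mathcal{H}$ with pairwise orthogonal ranges which generate $\mathcal{H}$ such that $$\Phi(A)=V\Big(\sum_\alpha U_\alpha A U_\alpha^*\Big)\qquad (A\in\mathcal{B}(\mathcal{H}));$$ (ii) there are a unitary operator $V$ on $\mathcal{H}$ and a collection $\{V_\beta\}$ of anti-isometries on $\mathcal{H}$ with pairwise orthogonal ranges which generate $\mathcal{H}$ such that $$\Phi(A)=V\Big(\sum_\beta V_\beta A^* V_\beta^*\Big)\qquad (A\in\mathcal{B}(\mathcal{H})).$$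
   Context: $\mathcal{B}(\mathcal{H})$ is the algebra of all bounded (complex-)linear operators on $\mathcal{H}$ with the operator norm. The unit ball of $\mathcal{B}(\mathcal{H})$ is $\{A\in\mathcal{B}(\mathcal{H}):\|A\|\le 1\}$. A linear map $\Phi:\mathcal{B}(\mathcal{H})\to\mathcal{B}(\mathcal{H})$ preserves the extreme points of the unit ball if $\Phi(A)$ is an extreme point of the unit ball whenever $A$ is one. No continuity of $\Phi$ is assumed. An isometry is a linear norm-preserving map $\mathcal{H}\to\mathcal{H}$; an anti-isometry is a conjugate-linear norm-preserving map $W:\mathcal{H}\to\mathcal{H}$, and its adjoint $W^*$ is the conjugate-linear map determined by $\langle Wx,y\rangle=\overline{\langle x,W^*y\rangle}$ for all $x,y\in\mathcal{H}$. The ranges generate $\mathcal{H}$ if the closed linear span of their union is $\mathcal{H}$. The sums (over possibly infinite index sets) are understood to converge in the strong operator topology. *)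

theory Defs
  imports "HOL-Analysis.Analysis"
begin

section \<open>Complex Hilbert spaces\<close>

class scaleC =
  fixes scaleC :: "complex \<Rightarrow> 'a \<Rightarrow> 'a"  (infixr \<open>*\<^sub>C\<close> 75)

class complex_vector = real_vector + scaleC +
  assumes scaleR_scaleC: "r *\<^sub>R x = complex_of_real r *\<^sub>C x"
    and scaleC_add_right: "c *\<^sub>C (x + y) = c *\<^sub>C x + c *\<^sub>C y"
    and scaleC_add_left: "(c + d) *\<^sub>C x = c *\<^sub>C x + d *\<^sub>C x"
    and scaleC_scaleC: "c *\<^sub>C d *\<^sub>C x = (c * d) *\<^sub>C x"
    and scaleC_one: "1 *\<^sub>C x = x"

global_interpretation complex_vector:
  vector_space "scaleC :: complex \<Rightarrow> 'a \<Rightarrow> 'a::complex_vector"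
  by unfold_locales
    (simp_all add: scaleC_add_right scaleC_add_left scaleC_scaleC scaleC_one)

class complex_normed_vector = complex_vector + real_normed_vector +
  assumes norm_scaleC: "norm (c *\<^sub>C x) = cmod c * norm x"

text \<open>The inner product is linear in its first argument.  The last axiom says that it is
  positive definite and that it induces the norm.\<close>

class complex_inner = complex_normed_vector +
  fixes cinner :: "'a \<Rightarrow> 'a \<Rightarrow> complex"
  assumes cinner_commute: "cinner x y = cnj (cinner y x)"
    and cinner_add_left: "cinner (x + y) z = cinner x z + cinner y z"
    and cinner_scaleC_left: "cinner (c *\<^sub>C x) y = c * cinner x y"
    and cinner_self: "cinner x x = complex_of_real ((norm x)\<^sup>2)"

class chilbert_space = complex_inner + complete_space

definition infinite_cdim :: "'a::complex_vector itself \<Rightarrow> bool" where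
  "infinite_cdim _ \<longleftrightarrow> \<not> (\<exists>B :: 'a set. finite B \<and> complex_vector.span B = UNIV)"


section \<open>The algebra of bounded operators\<close>

definition bounded_clinear :: "('a::complex_normed_vector \<Rightarrow> 'b::complex_normed_vector) \<Rightarrow> bool"
  where "bounded_clinear f \<longleftrightarrow> bounded_linear f \<and> (\<forall>c x. f (c *\<^sub>C x) = c *\<^sub>C f x)"

typedef (overloaded) 'a bop = "{f :: 'a::complex_normed_vector \<Rightarrow> 'a. bounded_clinear f}"
  morphisms bop_apply Bop
  by (rule exI [of _ "\<lambda>x. x"]) (simp add: bounded_clinear_def bounded_linear_ident)

setup_lifting type_definition_bop

declare [[coercion "bop_apply :: 'a::complex_normed_vector bop \<Rightarrow> 'a \<Rightarrow> 'a"]]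

lemma bounded_linear_scaleC_right:
  "bounded_linear (\<lambda>x :: 'a::complex_normed_vector. c *\<^sub>C x)"
  by (rule bounded_linear_intro [of _ "cmod c"])
    (simp_all add: scaleC_add_right scaleR_scaleC scaleC_scaleC norm_scaleC mult.commute)

instantiation bop :: (complex_normed_vector) complex_normed_vector
begin

lift_definition norm_bop :: "'a bop \<Rightarrow> real" is onorm .

lift_definition zero_bop :: "'a bop" is "\<lambda>x. 0"
  by (simp add: bounded_clinear_def complex_vector.scale_zero_right)

lift_definition uminus_bop :: "'a bop \<Rightarrow> 'a bop" is "\<lambda>f x. - f x"
  by (simp add: bounded_clinear_def bounded_linear_minus complex_vector.scale_minus_right)

lift_definition plus_bop :: "'a bop \<Rightarrow> 'a bop \<Rightarrow> 'a bop" is "\<lambda>f g x. f x + g x"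
  by (simp add: bounded_clinear_def bounded_linear_add scaleC_add_right)

lift_definition minus_bop :: "'a bop \<Rightarrow> 'a bop \<Rightarrow> 'a bop" is "\<lambda>f g x. f x - g x"
  by (simp add: bounded_clinear_def bounded_linear_sub complex_vector.scale_right_diff_distrib)

lift_definition scaleR_bop :: "real \<Rightarrow> 'a bop \<Rightarrow> 'a bop" is "\<lambda>r f x. r *\<^sub>R f x"
  by (auto simp: bounded_clinear_def scaleR_scaleC scaleC_scaleC mult.commute
      intro!: bounded_linear_compose [OF bounded_linear_scaleC_right])

lift_definition scaleC_bop :: "complex \<Rightarrow> 'a bop \<Rightarrow> 'a bop" is "\<lambda>c f x. c *\<^sub>C f x"
  by (auto simp: bounded_clinear_def scaleC_scaleC mult.commute
      intro!: bounded_linear_compose [OF bounded_linear_scaleC_right])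

definition sgn_bop :: "'a bop \<Rightarrow> 'a bop"
  where "sgn_bop A = inverse (norm A) *\<^sub>R A"

definition dist_bop :: "'a bop \<Rightarrow> 'a bop \<Rightarrow> real"
  where "dist_bop A B = norm (A - B)"

definition [code del]:
  "(uniformity :: ('a bop \<times> 'a bop) filter) =
    (INF e\<in>{0 <..}. principal {(x, y). dist x y < e})"

definition open_bop :: "'a bop set \<Rightarrow> bool"
  where [code del]: "open_bop S = (\<forall>x\<in>S. \<forall>\<^sub>F (x', y) in uniformity. x' = x \<longrightarrow> y \<in> S)"

lemma onorm_scaleC:
  fixes f :: "'b::complex_normed_vector \<Rightarrow> 'b"
  assumes f: "bounded_linear f"
  shows "onorm (\<lambda>x. c *\<^sub>C f x) = cmod c * onorm f"
proof -
  have "onorm (\<lambda>x. c *\<^sub>C f x) = onorm (\<lambda>x. cmod c *\<^sub>R f x)"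
    by (simp add: onorm_def norm_scaleC)
  then show ?thesis
    using f by (simp add: onorm_scaleR)
qed

instance
proof
  fix A B C :: "'a bop" and r s :: real and c d :: complex
  show "A + B + C = A + (B + C)" by transfer (simp add: add.assoc)
  show "A + B = B + A" by transfer (simp add: add.commute)
  show "0 + A = A" by transfer simp
  show "- A + A = 0" by transfer simp
  show "A - B = A + - B" by transfer simp
  show "r *\<^sub>R (A + B) = r *\<^sub>R A + r *\<^sub>R B" by transfer (simp add: scaleR_add_right)
  show "(r + s) *\<^sub>R A = r *\<^sub>R A + s *\<^sub>R A" by transfer (simp add: scaleR_add_left)
  show "r *\<^sub>R s *\<^sub>R A = (r * s) *\<^sub>R A" by transfer simp
  show "1 *\<^sub>R A = A" by transfer simp
  show "r *\<^sub>R A = complex_of_real r *\<^sub>C A" by transfer (simp add: scaleR_scaleC)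
  show "c *\<^sub>C (A + B) = c *\<^sub>C A + c *\<^sub>C B" by transfer (simp add: scaleC_add_right)
  show "(c + d) *\<^sub>C A = c *\<^sub>C A + d *\<^sub>C A" by transfer (simp add: scaleC_add_left)
  show "c *\<^sub>C d *\<^sub>C A = (c * d) *\<^sub>C A" by transfer (simp add: scaleC_scaleC)
  show "1 *\<^sub>C A = A" by transfer (simp add: scaleC_one)
  show "sgn A = inverse (norm A) *\<^sub>R A" by (rule sgn_bop_def)
  show "dist A B = norm (A - B)" by (rule dist_bop_def)
  show "(uniformity :: ('a bop \<times> 'a bop) filter) =
      (INF e\<in>{0 <..}. principal {(x, y). dist x y < e})" by (rule uniformity_bop_def)
  show "open S = (\<forall>x\<in>S. \<forall>\<^sub>F (x', y) in uniformity. x' = x \<longrightarrow> y \<in> S)" for S :: "'a bop set"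
    by (rule open_bop_def)
  show "norm A = 0 \<longleftrightarrow> A = 0"
    by transfer (simp add: bounded_clinear_def onorm_eq_0 fun_eq_iff)
  show "norm (A + B) \<le> norm A + norm B"
    by transfer (simp add: bounded_clinear_def onorm_triangle)
  show "norm (r *\<^sub>R A) = \<bar>r\<bar> * norm A"
    by transfer (simp add: bounded_clinear_def onorm_scaleR)
  show "norm (c *\<^sub>C A) = cmod c * norm A"
    by transfer (simp add: bounded_clinear_def onorm_scaleC)
qed

end

lift_definition bop_id :: "'a::complex_normed_vector bop" is "\<lambda>x. x"
  by (simp add: bounded_clinear_def bounded_linear_ident)

lift_definition bop_compose ::
    "'a::complex_normed_vector bop \<Rightarrow> 'a bop \<Rightarrow> 'a bop"  (infixl \<open>o\<^sub>B\<close> 55)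
  is "\<lambda>f g x. f (g x)"
  by (simp add: bounded_clinear_def bounded_linear_compose)

definition adj :: "'a::chilbert_space bop \<Rightarrow> 'a bop" where
  "adj A = (THE B :: 'a bop. \<forall>x y. cinner (A x) y = cinner x (B y))"

definition unitary :: "'a::chilbert_space bop \<Rightarrow> bool" where
  "unitary V \<longleftrightarrow> adj V o\<^sub>B V = bop_id \<and> V o\<^sub>B adj V = bop_id"

definition isometry :: "'a::chilbert_space bop \<Rightarrow> bool" where
  "isometry U \<longleftrightarrow> (\<forall>x. norm (U x) = norm x)"


section \<open>Conjugate-linear isometries\<close>

definition conj_linear :: "('a::complex_vector \<Rightarrow> 'a) \<Rightarrow> bool" where
  "conj_linear W \<longleftrightarrow>
    (\<forall>x y. W (x + y) = W x + W y) \<and> (\<forall>c x. W (c *\<^sub>C x) = cnj c *\<^sub>C W x)"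

definition anti_isometry :: "('a::chilbert_space \<Rightarrow> 'a) \<Rightarrow> bool" where
  "anti_isometry W \<longleftrightarrow> conj_linear W \<and> (\<forall>x. norm (W x) = norm x)"

definition anti_adj :: "('a::chilbert_space \<Rightarrow> 'a) \<Rightarrow> 'a \<Rightarrow> 'a" where
  "anti_adj W = (THE W'. conj_linear W' \<and> (\<forall>x y. cinner (W x) y = cnj (cinner x (W' y))))"


section \<open>Orthogonal ranges, strong sums and extreme points\<close>

text \<open>A family of isometries with pairwise orthogonal ranges on a nonzero space has no
  repetitions; such families are therefore represented by the sets of their members.\<close>

definition orthogonal_ranges :: "('a::chilbert_space \<Rightarrow> 'a) \<Rightarrow> ('a \<Rightarrow> 'a) \<Rightarrow> bool" where
  "orthogonal_ranges f g \<longleftrightarrow> (\<forall>x \<in> range f. \<forall>y \<in> range g. cinner x y = 0)"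

definition ranges_generate :: "('a::chilbert_space \<Rightarrow> 'a) set \<Rightarrow> bool" where
  "ranges_generate F \<longleftrightarrow> closure (complex_vector.span (\<Union>f\<in>F. range f)) = UNIV"

text \<open>Unconditional convergence in the strong operator topology.  The summands are plain functions
  because products of linear and conjugate-linear maps occur.\<close>

definition has_sot_sum ::
    "('i \<Rightarrow> 'a::chilbert_space \<Rightarrow> 'a) \<Rightarrow> 'a bop \<Rightarrow> 'i set \<Rightarrow> bool" where
  "has_sot_sum f S I \<longleftrightarrow> (\<forall>x. ((\<lambda>i. f i x) has_sum S x) I)"

definition preserves_extreme_points ::
    "('a::chilbert_space bop \<Rightarrow> 'a bop) \<Rightarrow> bool" where
  "preserves_extreme_points \<Phi> \<longleftrightarrow>
    (\<forall>A. A extreme_point_of cball 0 1 \<longrightarrow> \<Phi> A extreme_point_of cball 0 1)"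

end

theory Submission
  imports Defs
begin

text \<open>The extreme points of the unit ball are the isometries and the coisometries.  Let \<open>S\<close>, \<open>T\<close> be
  isometries with complementary ranges.  If \<open>\<Phi> S\<close> is an isometry, then so are \<open>\<Phi> (S U)\<close> and
  \<open>\<Phi> (T U)\<close> for all isometries \<open>U\<close>, because all \<open>a S U + b T U'\<close> with
  \<open>\<bar>a\<bar>\<^sup>2 + \<bar>b\<bar>\<^sup>2 = 1\<close> are extreme and an isometry cannot be
  joined to a proper coisometry by a norm-continuous path of extreme points; the images then have
  orthogonal ranges.  Applied to \<open>S U \<plusminus> T\<close> this shows that \<open>\<langle>\<Phi> (S A) x, \<Phi> (S B) y\<rangle>\<close>
  depends only on \<open>A\<^sup>*B\<close>, as the unitaries span, and hence \<open>\<Phi>(A)\<^sup>*\<Phi>(B) = \<Phi>(1)\<^sup>*\<Phi>(A\<^sup>*B)\<close>.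
  In this case \<open>\<Phi> (S\<^sup>*)\<close> must be a coisometry, and the same argument for
  \<open>A \<mapsto> \<Phi>(A\<^sup>*)\<^sup>*\<close> shows that \<open>V = \<Phi>(1)\<close> is unitary, so \<open>V\<^sup>*\<Phi>\<close> is a unital
  \<open>*\<close>-homomorphism.  If \<open>\<Phi> S\<close> is a coisometry, then \<open>A \<mapsto> \<Phi>(A\<^sup>*)\<close> is covered by the
  conjugate-linear version of this.  Finally, a unital \<open>*\<close>-homomorphism of \<open>\<B>(\<H>)\<close> into itself
  is a sum of copies of the identity, since on a separable space it has no part vanishing on the
  finite rank operators.\<close>

section \<open>Inner product spaces\<close>

lemma cinner_add_right: "cinner x (y + z) = cinner x y + cinner x z"
  for x :: "'a::complex_inner"
  by (metis cinner_add_left cinner_commute complex_cnj_add)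

lemma cinner_scaleC_right: "cinner x (c *\<^sub>C y) = cnj c * cinner x y"
  for x :: "'a::complex_inner"
  by (metis cinner_scaleC_left cinner_commute complex_cnj_mult)

lemma cinner_zero_left [simp]: "cinner 0 x = 0" and cinner_zero_right [simp]: "cinner x 0 = 0"
  for x :: "'a::complex_inner"
  using cinner_add_left [of 0 0 x] cinner_add_right [of x 0 0] by simp_all

lemma cinner_minus_left: "cinner (- x) y = - cinner x y"
  and cinner_minus_right: "cinner x (- y) = - cinner x y"
  for x :: "'a::complex_inner"
  using cinner_add_left [of x "- x" y] cinner_add_right [of x y "- y"]
  by (simp_all add: eq_neg_iff_add_eq_0 add.commute)

lemma cinner_diff_left: "cinner (x - y) z = cinner x z - cinner y z"
  and cinner_diff_right: "cinner z (x - y) = cinner z x - cinner z y"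
  for x :: "'a::complex_inner"
  by (simp_all only: diff_conv_add_uminus cinner_add_left cinner_add_right
      cinner_minus_left cinner_minus_right)

lemma cinner_scaleR_left: "cinner (r *\<^sub>R x) y = complex_of_real r * cinner x y"
  and cinner_scaleR_right: "cinner x (r *\<^sub>R y) = complex_of_real r * cinner x y"
  for x :: "'a::complex_inner"
  by (simp_all add: scaleR_scaleC cinner_scaleC_left cinner_scaleC_right)

lemmas cinner_simps = cinner_add_left cinner_add_right cinner_diff_left cinner_diff_right
  cinner_minus_left cinner_minus_right cinner_scaleC_left cinner_scaleC_right
  cinner_scaleR_left cinner_scaleR_right

lemma Re_cinner_self: "Re (cinner x x) = (norm x)\<^sup>2"
  by (simp add: cinner_self)

lemma Re_cinner_commute: "Re (cinner x y) = Re (cinner y x)"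
  by (subst cinner_commute) simp

lemma norm_add_sq: "(norm (x + y))\<^sup>2 = (norm x)\<^sup>2 + (norm y)\<^sup>2 + 2 * Re (cinner x y)"
  for x :: "'a::complex_inner"
  unfolding Re_cinner_self [symmetric] using Re_cinner_commute [of x y] by (simp add: cinner_simps)

lemma norm_diff_sq: "(norm (x - y))\<^sup>2 = (norm x)\<^sup>2 + (norm y)\<^sup>2 - 2 * Re (cinner x y)"
  for x :: "'a::complex_inner"
  using norm_add_sq [of x "- y"] by (simp add: cinner_simps)

lemma cinner_eq_zeroI: "cinner x x = 0 \<Longrightarrow> x = 0"
  by (simp add: cinner_self)

lemma cinner_ext: "(\<And>x. cinner x y = cinner x z) \<Longrightarrow> y = z"
  for y :: "'a::complex_inner"
  using cinner_eq_zeroI [of "y - z"] by (simp add: cinner_simps)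

lemma cinner_ext_left: "(\<And>x. cinner y x = cinner z x) \<Longrightarrow> y = z"
  for y :: "'a::complex_inner"
  using cinner_eq_zeroI [of "y - z"] by (simp add: cinner_simps)

text \<open>The triangle inequality belongs to the class, and its square, expanded by
  \<open>norm_add_sq\<close>, is this half of Cauchy-Schwarz.\<close>

lemma Re_cinner_le: "Re (cinner x y) \<le> norm x * norm y"
  for x :: "'a::complex_inner"
proof -
  have "(norm (x + y))\<^sup>2 \<le> (norm x + norm y)\<^sup>2"
    by (intro power_mono norm_triangle_ineq norm_ge_zero)
  then show ?thesis
    by (simp add: norm_add_sq power2_sum)
qed

lemma norm_cinner_le: "cmod (cinner x y) \<le> norm x * norm y"
  for x :: "'a::complex_inner"
proof (cases "cinner x y = 0")
  case False
  \<comment> \<open>\<open>c\<close> is the phase that rotates \<open>cinner x y\<close> onto its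
    modulus, which reduces the claim to the real part.\<close>
  define c where "c = cnj (cinner x y) / cmod (cinner x y)"
  have "cinner (c *\<^sub>C x) y = cmod (cinner x y)"
    using False by (simp add: c_def cinner_simps field_simps complex_norm_square [symmetric]
        power2_eq_square)
  moreover have "norm (c *\<^sub>C x) = norm x"
    using False by (simp add: c_def norm_scaleC norm_divide)
  ultimately show ?thesis
    using Re_cinner_le [of "c *\<^sub>C x" y] by simp
qed simp

lemma bounded_linear_cinner_left: "bounded_linear (\<lambda>x. cinner x y)"
  by (rule bounded_linear_intro [of _ "norm y"])
    (simp_all add: cinner_simps norm_cinner_le scaleR_conv_of_real)

lemma bounded_linear_cinner_right: "bounded_linear (\<lambda>y. cinner x y)"
  by (rule bounded_linear_intro [of _ "norm x"])
    (simp_all add: cinner_simps scaleR_conv_of_real,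
      metis mult.commute norm_cinner_le)

lemmas bounded_linear_Re_cinner_right =
  bounded_linear_compose [OF bounded_linear_Re bounded_linear_cinner_right]

lemma continuous_on_cinner_right: "continuous_on A (\<lambda>y. cinner x y)"
  by (intro linear_continuous_on bounded_linear_cinner_right)

lemma closed_orthogonal: "closed {y. cinner x y = 0}" for x :: "'a::complex_inner"
  by (intro closed_Collect_eq continuous_on_cinner_right continuous_on_const)

lemma subspace_orthogonal: "complex_vector.subspace {y. cinner x y = 0}" for x :: "'a::complex_inner"
  by (rule complex_vector.subspaceI) (simp_all add: cinner_simps)

lemma orthogonal_closure_span:
  fixes x :: "'a::complex_inner"
  assumes "\<And>y. y \<in> Y \<Longrightarrow> cinner x y = 0" and z: "z \<in> closure (complex_vector.span Y)"
  shows "cinner x z = 0"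
proof -
  have "complex_vector.span Y \<subseteq> {y. cinner x y = 0}"
    by (intro complex_vector.span_minimal subspace_orthogonal) (use assms in auto)
  then have "closure (complex_vector.span Y) \<subseteq> {y. cinner x y = 0}"
    by (intro closure_minimal closed_orthogonal)
  then show ?thesis using z by auto
qed

instance chilbert_space \<subseteq> banach ..

text \<open>The representing vector is the minimum of \<open>\<lambda>m. \<parallel>m\<parallel>\<^sup>2 - 2 Re (f m)\<close> on the subspace.
  For \<open>M = UNIV\<close> this is the Riesz theorem; for \<open>f m = \<langle>m, x\<rangle>\<close> it gives the orthogonal projection.\<close>

lemma riesz_on_subspace:
  fixes M :: "'a::chilbert_space set" and f :: "'a \<Rightarrow> real"
  assumes M: "subspace M" "closed M" and f: "bounded_linear f"
  obtains y where "y \<in> M" "\<And>m. m \<in> M \<Longrightarrow> f m = Re (cinner m y)"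
proof -
  interpret f: bounded_linear f by fact
  define J where "J m = (norm m)\<^sup>2 - 2 * f m" for m
  obtain K where K: "\<And>m. norm (f m) \<le> norm m * K" using f.bounded by blast
  have lower: "- K\<^sup>2 \<le> J m" for m
  proof -
    have "f m \<le> norm m * K" using K [of m] by simp
    moreover have "0 \<le> (norm m - K)\<^sup>2" by simp
    ultimately show ?thesis unfolding J_def power2_diff by simp
  qed
  define d where "d = Inf (J ` M)"
  have bdd: "bdd_below (J ` M)" using lower by (auto intro!: bdd_belowI [of _ "- K\<^sup>2"])
  have M0: "0 \<in> M" using M(1) by (rule subspace_0)
  have d_le: "d \<le> J m" if "m \<in> M" for m
    unfolding d_def using bdd that by (auto intro: cInf_lower)
  have "\<exists>m\<in>M. J m < d + 1 / real (Suc n)" for n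
  proof -
    have "\<exists>r\<in>J ` M. r < d + 1 / real (Suc n)"
      unfolding d_def by (rule cInf_lessD) (use M0 in auto)
    then show ?thesis by auto
  qed
  then obtain m where mM: "\<And>n. m n \<in> M" and mJ: "\<And>n. J (m n) < d + 1 / real (Suc n)"
    by metis
  \<comment> \<open>Parallelogram law; the linear part of \<open>J\<close> cancels because
    \<open>f\<close> respects midpoints.\<close>
  have par: "(norm (a - b))\<^sup>2 = 2 * J a + 2 * J b - 4 * J ((1/2) *\<^sub>R (a + b))" for a b
  proof -
    have "(norm ((1/2) *\<^sub>R (a + b)))\<^sup>2 = (norm (a + b))\<^sup>2 / 4"
      by (simp add: power_divide)
    moreover have "f ((1/2) *\<^sub>R (a + b)) = (f a + f b) / 2"
      by (simp add: f.add f.scaleR)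
    ultimately show ?thesis
      unfolding J_def norm_diff_sq by (simp add: norm_add_sq field_simps)
  qed
  have gap: "(norm (a - b))\<^sup>2 \<le> 2 * (J a - d) + 2 * (J b - d)" if "a \<in> M" "b \<in> M" for a b
  proof -
    have "(1/2) *\<^sub>R (a + b) \<in> M" using that M(1) by (simp add: subspace_add subspace_mul)
    from d_le [OF this] show ?thesis using par [of a b] by simp
  qed
  have "Cauchy m"
  proof (rule metric_CauchyI)
    fix e :: real assume e: "e > 0"
    \<comment> \<open>By \<open>gap\<close> each point contributes twice its excess over
      \<open>d\<close>, so excesses below \<open>e\<^sup>2 / 4\<close> give a distance below
      \<open>e\<close>.\<close>
    then obtain N where N: "inverse (real (Suc N)) < e\<^sup>2 / 4"
      using reals_Archimedean [of "e\<^sup>2 / 4"] by auto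
    have J: "J (m p) - d < e\<^sup>2 / 4" if "p \<ge> N" for p
    proof -
      have "inverse (real (Suc p)) \<le> inverse (real (Suc N))" using that by simp
      with mJ [of p] N show ?thesis unfolding inverse_eq_divide by argo
    qed
    have "dist (m p) (m q) < e" if "p \<ge> N" "q \<ge> N" for p q
    proof -
      have "(norm (m p - m q))\<^sup>2 < e\<^sup>2"
        using gap [OF mM mM, of p q] J [OF that(1)] J [OF that(2)] by argo
      then show ?thesis using e by (simp add: dist_norm power2_less_imp_less)
    qed
    then show "\<exists>N. \<forall>p\<ge>N. \<forall>q\<ge>N. dist (m p) (m q) < e" by blast
  qed
  then obtain y where y: "m \<longlonglongrightarrow> y" using Cauchy_convergent convergent_def by blast
  have yM: "y \<in> M" using M(2) mM y closed_sequentially by blast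
  have "(\<lambda>n. J (m n)) \<longlonglongrightarrow> J y"
    unfolding J_def by (intro tendsto_intros f.tendsto y)
  moreover have "(\<lambda>n. d + 1 / real (Suc n)) \<longlonglongrightarrow> d"
    using tendsto_add [OF tendsto_const LIMSEQ_inverse_real_of_nat, of d]
    by (simp add: inverse_eq_divide)
  ultimately have Jy: "J y \<le> d"
    by (rule LIMSEQ_le) (use mJ less_imp_le in blast)
  have "f x = Re (cinner x y)" if x: "x \<in> M" for x
  proof -
    define b where "b = Re (cinner x y) - f x"
    have q: "0 \<le> t\<^sup>2 * (norm x)\<^sup>2 + 2 * t * b" for t
    proof -
      have "y + t *\<^sub>R x \<in> M" using x yM M(1) by (simp add: subspace_add subspace_mul)
      then have "J y \<le> J (y + t *\<^sub>R x)" using d_le Jy by force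
      then show ?thesis
        using Re_cinner_commute [of x y]
        by (simp add: J_def b_def norm_add_sq f.add f.scaleR cinner_simps power_mult_distrib algebra_simps)
    qed
    have "b = 0"
    proof (rule ccontr)
      assume b: "b \<noteq> 0"
      \<comment> \<open>\<open>t\<close> minimises the majorant
        \<open>t\<^sup>2 * ((norm x)\<^sup>2 + 1) + 2 * t * b\<close>; the added 1 keeps the
        denominator positive also for \<open>x = 0\<close>.\<close>
      define t where "t = - b / ((norm x)\<^sup>2 + 1)"
      have p: "(norm x)\<^sup>2 + 1 > 0" by (simp add: add_nonneg_pos)
      have "t\<^sup>2 * (norm x)\<^sup>2 + 2 * t * b \<le> t\<^sup>2 * ((norm x)\<^sup>2 + 1) + 2 * t * b"
        by (simp add: algebra_simps)
      also have "\<dots> = - b\<^sup>2 / ((norm x)\<^sup>2 + 1)"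
        using p unfolding t_def by (simp add: power2_eq_square divide_simps)
      also have "\<dots> < 0" using b p by simp
      finally show False using q [of t] by simp
    qed
    then show ?thesis by (simp add: b_def)
  qed
  then show thesis using that yM by blast
qed

lemma complex_subspace_imp_subspace: "complex_vector.subspace M \<Longrightarrow> subspace M"
  by (auto simp: subspace_def complex_vector.subspace_def scaleR_scaleC)

lemma subspace_closure:
  fixes S :: "'a::real_normed_vector set"
  assumes S: "subspace S"
  shows "subspace (closure S)"
proof (rule subspaceI)
  show "0 \<in> closure S" using subspace_0 [OF S] closure_subset by blast
  show "x + y \<in> closure S" if xy: "x \<in> closure S" "y \<in> closure S" for x y
  proof -
    obtain f g where "\<And>n. f n \<in> S" "f \<longlonglongrightarrow> x" "\<And>n. g n \<in> S" "g \<longlonglongrightarrow> y"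
      using xy unfolding closure_sequential by blast
    then have "(\<forall>n. f n + g n \<in> S) \<and> (\<lambda>n. f n + g n) \<longlonglongrightarrow> x + y"
      by (simp add: subspace_add [OF S] tendsto_add)
    then show ?thesis unfolding closure_sequential by (intro exI [of _ "\<lambda>n. f n + g n"])
  qed
  show "c *\<^sub>R x \<in> closure S" if x: "x \<in> closure S" for c x
  proof -
    obtain f where "\<And>n. f n \<in> S" "f \<longlonglongrightarrow> x"
      using x unfolding closure_sequential by blast
    then have "(\<forall>n. c *\<^sub>R f n \<in> S) \<and> (\<lambda>n. c *\<^sub>R f n) \<longlonglongrightarrow> c *\<^sub>R x"
      by (simp add: subspace_mul [OF S] tendsto_scaleR)
    then show ?thesis unfolding closure_sequential by (intro exI [of _ "\<lambda>n. c *\<^sub>R f n"])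
  qed
qed

text \<open>The witness is \<open>x - p\<close>, where \<open>x\<close> lies outside the closed span
  and \<open>p\<close> is its orthogonal projection, obtained from
  \<open>riesz_on_subspace\<close>.\<close>

lemma exists_orthogonal:
  fixes Y :: "'a::chilbert_space set"
  assumes "closure (complex_vector.span Y) \<noteq> UNIV"
  obtains z where "z \<noteq> 0" "\<And>y. y \<in> Y \<Longrightarrow> cinner z y = 0"
proof -
  let ?S = "complex_vector.span Y" let ?M = "closure ?S"
  obtain x where x: "x \<notin> ?M" using assms by auto
  have "subspace ?M"
    by (intro subspace_closure complex_subspace_imp_subspace complex_vector.subspace_span)
  then obtain p where p: "p \<in> ?M" and pm: "\<And>m. m \<in> ?M \<Longrightarrow> Re (cinner x m) = Re (cinner m p)"
    using riesz_on_subspace [OF _ closed_closure bounded_linear_Re_cinner_right, of _ x] by blast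
  have Re0: "Re (cinner (x - p) y) = 0" if "y \<in> ?S" for y
    using pm [of y] that closure_subset [of ?S] Re_cinner_commute [of y p]
    by (auto simp: cinner_simps)
  have "cinner (x - p) y = 0" if "y \<in> Y" for y
  proof (rule complex_eqI)
    have yS: "y \<in> ?S" using that by (rule complex_vector.span_base)
    then show "Re (cinner (x - p) y) = Re 0" using Re0 by simp
    \<comment> \<open>The span is complex, so real orthogonality to \<open>\<i> *\<^sub>C y\<close>
      supplies the imaginary part.\<close>
    from Re0 [OF complex_vector.span_scale [OF yS, of \<i>]]
    show "Im (cinner (x - p) y) = Im 0" by (simp add: cinner_scaleC_right)
  qed
  moreover have "x - p \<noteq> 0" using x p by auto
  ultimately show thesis using that by blast
qed

text \<open>The real version represents \<open>Re (f x)\<close>; evaluation at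
  \<open>\<i> *\<^sub>C x\<close> recovers the imaginary part.\<close>

lemma riesz:
  fixes f :: "'a::chilbert_space \<Rightarrow> complex"
  assumes f: "bounded_linear f" and hom: "\<And>c x. f (c *\<^sub>C x) = c * f x"
  obtains y where "\<And>x. f x = cinner x y"
proof -
  obtain y where y: "\<And>x. Re (f x) = Re (cinner x y)"
    using riesz_on_subspace [OF subspace_UNIV closed_UNIV
        bounded_linear_compose [OF bounded_linear_Re f]] by auto
  have "f x = cinner x y" for x
    using y [of x] y [of "\<i> *\<^sub>C x"] by (simp add: complex_eq_iff hom cinner_simps)
  then show thesis using that by blast
qed

section \<open>Semilinear maps and adjoints\<close>

text \<open>Linear and conjugate-linear maps are treated together: the parameter \<open>\<sigma>\<close> is the identity
  for the former and complex conjugation for the latter.\<close>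

definition semilinear ::
    "(complex \<Rightarrow> complex) \<Rightarrow> ('a::complex_vector \<Rightarrow> 'b::complex_vector) \<Rightarrow> bool" where
  "semilinear \<sigma> W \<longleftrightarrow> (\<forall>x y. W (x + y) = W x + W y) \<and> (\<forall>c x. W (c *\<^sub>C x) = \<sigma> c *\<^sub>C W x)"

text \<open>For the identity this is the relation that determines \<open>adj\<close>, for
  \<open>cnj\<close> the one that determines \<open>anti_adj\<close>.\<close>

definition is_adj ::
    "(complex \<Rightarrow> complex) \<Rightarrow> ('a::complex_inner \<Rightarrow> 'b::complex_inner) \<Rightarrow> ('b \<Rightarrow> 'a) \<Rightarrow> bool" where
  "is_adj \<sigma> W W' \<longleftrightarrow> (\<forall>x y. cinner (W x) y = \<sigma> (cinner x (W' y)))"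

abbreviation linear_adj :: "('a::complex_inner \<Rightarrow> 'b::complex_inner) \<Rightarrow> ('b \<Rightarrow> 'a) \<Rightarrow> bool"
  where "linear_adj \<equiv> is_adj (\<lambda>z. z)"

locale conj_or_id =
  fixes \<sigma> :: "complex \<Rightarrow> complex"
  assumes sigma: "\<sigma> = (\<lambda>z. z) \<or> \<sigma> = cnj"
begin

lemma sigma_simps:
  "\<sigma> (\<sigma> z) = z" "\<sigma> (z + w) = \<sigma> z + \<sigma> w" "\<sigma> (z * w) = \<sigma> z * \<sigma> w" "\<sigma> 0 = 0" "\<sigma> 1 = 1"
  "\<sigma> (complex_of_real r) = complex_of_real r" "cmod (\<sigma> z) = cmod z" "Re (\<sigma> z) = Re z"
  "\<sigma> (cnj z) = cnj (\<sigma> z)" "\<sigma> (- z) = - \<sigma> z" "\<sigma> (z - w) = \<sigma> z - \<sigma> w"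
  using sigma by auto

lemma sigma_eq_iff: "\<sigma> z = w \<longleftrightarrow> z = \<sigma> w"
  by (auto simp: sigma_simps)

lemma bounded_linear_sigma: "bounded_linear \<sigma>"
  using sigma bounded_linear_ident bounded_linear_cnj by auto

lemma semilinearD:
  assumes "semilinear \<sigma> W"
  shows "W (x + y) = W x + W y" "W (c *\<^sub>C x) = \<sigma> c *\<^sub>C W x" "W 0 = 0" "W (x - y) = W x - W y"
    "W (- x) = - W x" "W (r *\<^sub>R x) = r *\<^sub>R W x"
proof -
  show *: "W (x + y) = W x + W y" "W (c *\<^sub>C x) = \<sigma> c *\<^sub>C W x" for x y c
    using assms by (auto simp: semilinear_def)
  from *(2) [of 0 0] show "W 0 = 0" by (simp add: complex_vector.scale_zero_left sigma_simps)
  show neg: "W (- x) = - W x" for x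
    using *(2) [of "- 1" x] by (simp add: complex_vector.scale_minus_left scaleC_one sigma_simps)
  show "W (x - y) = W x - W y"
    using *(1) [of x "- y"] neg by simp
  show "W (r *\<^sub>R x) = r *\<^sub>R W x"
    by (simp add: scaleR_scaleC *(2) sigma_simps)
qed

lemma semilinear_sum: "semilinear \<sigma> W \<Longrightarrow> W (\<Sum>i\<in>F. f i) = (\<Sum>i\<in>F. W (f i))"
  by (induction F rule: infinite_finite_induct) (simp_all add: semilinearD)

lemma is_adjD:
  assumes "is_adj \<sigma> W W'"
  shows "cinner (W x) y = \<sigma> (cinner x (W' y))" "cinner (W' y) x = \<sigma> (cinner y (W x))"
    "cinner y (W x) = \<sigma> (cinner (W' y) x)"
proof -
  show *: "cinner (W x) y = \<sigma> (cinner x (W' y))"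
    using assms by (auto simp: is_adj_def)
  then have "\<sigma> (cinner x (W' y)) = cinner (W x) y" by (simp add: sigma_simps)
  then have "cinner x (W' y) = \<sigma> (cinner (W x) y)" by (simp add: sigma_eq_iff)
  then show "cinner (W' y) x = \<sigma> (cinner y (W x))"
    by (metis cinner_commute sigma_simps(9))
  then show "cinner y (W x) = \<sigma> (cinner (W' y) x)" by (simp add: sigma_simps)
qed

lemma is_adj_sym: "is_adj \<sigma> W W' \<Longrightarrow> is_adj \<sigma> W' W"
  unfolding is_adj_def by (metis is_adjD(2) is_adj_def)

lemma is_adj_unique: "is_adj \<sigma> W W' \<Longrightarrow> is_adj \<sigma> W W'' \<Longrightarrow> W' = W''"
proof
  fix y assume W: "is_adj \<sigma> W W'" "is_adj \<sigma> W W''"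
  show "W' y = W'' y"
  proof (rule cinner_ext)
    fix x
    have "\<sigma> (cinner x (W' y)) = \<sigma> (cinner x (W'' y))"
      using W by (metis is_adj_def)
    then show "cinner x (W' y) = cinner x (W'' y)" by (metis sigma_simps(1))
  qed
qed

lemma is_adj_semilinear:
  assumes "is_adj \<sigma> W W'"
  shows "semilinear \<sigma> W'"
  unfolding semilinear_def
proof (intro conjI allI)
  show "W' (x + y) = W' x + W' y" for x y
    by (rule cinner_ext_left) (simp add: is_adjD(2) [OF assms] cinner_simps sigma_simps)
  show "W' (c *\<^sub>C x) = \<sigma> c *\<^sub>C W' x" for c x
    by (rule cinner_ext_left) (simp add: is_adjD(2) [OF assms] cinner_simps sigma_simps)
qed

text \<open>\<open>W' y\<close> is the Riesz vector of
  \<open>x \<mapsto> \<sigma> (cinner (W x) y)\<close>, which is complex linear because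
  \<open>\<sigma>\<close> undoes the semilinearity of \<open>W\<close>. The bound comes from
  evaluating at \<open>x = W' y\<close>.\<close>

lemma is_adj_exists:
  fixes W :: "'a::chilbert_space \<Rightarrow> 'b::complex_inner"
  assumes W: "semilinear \<sigma> W" and bound: "\<And>x. norm (W x) \<le> K * norm x"
    and K: "0 \<le> K"
  obtains W' where "is_adj \<sigma> W W'" "\<And>y. norm (W' y) \<le> K * norm y"
proof -
  have lin: "bounded_linear (\<lambda>x. \<sigma> (cinner (W x) y))" for y
  proof (rule bounded_linear_compose [OF bounded_linear_sigma
        bounded_linear_compose [OF bounded_linear_cinner_left]])
    show "bounded_linear W"
      by (rule bounded_linear_intro [of _ K])
        (simp_all add: semilinearD [OF W] bound mult.commute [of _ K])
  qed
  have "\<exists>w. \<forall>x. \<sigma> (cinner (W x) y) = cinner x w" for y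
  proof -
    have "\<sigma> (cinner (W (c *\<^sub>C x)) y) = c * \<sigma> (cinner (W x) y)" for c x
      by (simp add: semilinearD [OF W] cinner_simps sigma_simps)
    then show ?thesis by (metis riesz [OF lin [of y]])
  qed
  then obtain W' where W': "\<And>x y. \<sigma> (cinner (W x) y) = cinner x (W' y)" by metis
  then have adj: "is_adj \<sigma> W W'" unfolding is_adj_def by (metis sigma_simps(1))
  have "norm (W' y) \<le> K * norm y" for y
  proof (cases "W' y = 0")
    case True
    then show ?thesis using K by simp
  next
    case False
    have "(norm (W' y))\<^sup>2 = cmod (cinner (W' y) (W' y))" by (simp add: cinner_self norm_power)
    also have "\<dots> = cmod (cinner (W (W' y)) y)" by (simp add: W' [symmetric] sigma_simps)
    also have "\<dots> \<le> norm (W (W' y)) * norm y" by (rule norm_cinner_le)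
    also have "\<dots> \<le> K * norm (W' y) * norm y" by (intro mult_right_mono bound norm_ge_zero)
    finally show ?thesis using False by (simp add: power2_eq_square)
  qed
  with adj show thesis using that by blast
qed

text \<open>Polarization: the norm of \<open>x + y\<close> gives the real part, and
  \<open>\<i> *\<^sub>C x\<close> in place of \<open>x\<close> the imaginary part, up to the sign
  recorded by \<open>\<sigma>\<close>.\<close>

lemma semilinear_isometry_cinner:
  fixes W :: "'a::complex_inner \<Rightarrow> 'b::complex_inner"
  assumes W: "semilinear \<sigma> W" and norm: "\<And>x. norm (W x) = norm x"
  shows "cinner (W x) (W y) = \<sigma> (cinner x y)"
proof -
  have Re: "Re (cinner (W x) (W y)) = Re (cinner x y)" for x y
    using norm_add_sq [of "W x" "W y"] norm_add_sq [of x y]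
    by (simp add: norm semilinearD(1) [OF W, symmetric])
  show ?thesis
    using Re [of x y] Re [of "\<i> *\<^sub>C x" y] sigma
    by (auto simp: complex_eq_iff semilinearD [OF W] cinner_simps)
qed

lemma isometry_adj_left_inverse:
  fixes W :: "'a::complex_inner \<Rightarrow> 'b::complex_inner"
  assumes "semilinear \<sigma> W" "\<And>x. norm (W x) = norm x" "is_adj \<sigma> W W'"
  shows "W' (W x) = x"
  by (rule cinner_ext_left) (simp add: is_adjD(2) [OF assms(3)] semilinear_isometry_cinner [OF assms(1,2)] sigma_simps)

end

interpretation idc: conj_or_id "\<lambda>z. z"
  by (intro conj_or_id.intro disjI1 refl)

interpretation cnjc: conj_or_id cnj
  by (intro conj_or_id.intro disjI2 refl)

lemma conj_linear_eq: "conj_linear W = semilinear cnj W"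
  by (simp add: conj_linear_def semilinear_def)

lemma anti_adj_eqI: "is_adj cnj W W' \<Longrightarrow> anti_adj W = W'"
  unfolding anti_adj_def
proof (rule the_equality)
  assume *: "is_adj cnj W W'"
  then show "conj_linear W' \<and> (\<forall>x y. cinner (W x) y = cnj (cinner x (W' y)))"
    by (auto simp: conj_linear_eq cnjc.is_adj_semilinear is_adj_def)
  show "V = W'" if "conj_linear V \<and> (\<forall>x y. cinner (W x) y = cnj (cinner x (V y)))" for V
    by (rule cnjc.is_adj_unique [OF _ *]) (use that in \<open>simp add: is_adj_def\<close>)
qed

lemma is_adj_anti_adj:
  assumes "anti_isometry W"
  shows "is_adj cnj W (anti_adj W)"
proof -
  have "semilinear cnj W" "\<And>x. norm (W x) \<le> 1 * norm x"
    using assms by (simp_all add: anti_isometry_def conj_linear_eq)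
  from cnjc.is_adj_exists [OF this zero_le_one] obtain W' where W': "is_adj cnj W W'" .
  then show ?thesis by (simp add: anti_adj_eqI [OF W'])
qed


section \<open>Operators\<close>

lemma bounded_clinear_bop: "bounded_clinear (bop_apply A)"
  using bop_apply by auto

lemma bounded_linear_bop: "bounded_linear (bop_apply A)"
  using bounded_clinear_bop [of A] by (simp add: bounded_clinear_def)

lemma semilinear_bop: "semilinear (\<lambda>z. z) (bop_apply A)"
  using bounded_clinear_bop [of A]
  by (auto simp: bounded_clinear_def semilinear_def linear_simps)

lemmas bop_linear = idc.semilinearD [OF semilinear_bop]

lemma bop_eqI: "(\<And>x. bop_apply A x = bop_apply B x) \<Longrightarrow> A = B"
  by (metis bop_apply_inject ext)

lemma bop_apply_simps [simp]:
  "bop_apply (A + B) x = A x + B x" "bop_apply (A - B) x = A x - B x" "bop_apply (- A) x = - A x"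
  "bop_apply 0 x = 0" "bop_apply (c *\<^sub>C A) x = c *\<^sub>C A x" "bop_apply (r *\<^sub>R A) x = r *\<^sub>R A x"
  "bop_apply bop_id x = x" "bop_apply (A o\<^sub>B B) x = A (B x)"
  by (transfer; simp)+

lemma norm_bop_apply: "norm (bop_apply A x) \<le> norm A * norm x"
  using onorm [OF bounded_linear_bop] by (simp add: norm_bop.rep_eq)

lemma norm_bop_leI: "(\<And>x. norm (bop_apply A x) \<le> K * norm x) \<Longrightarrow> 0 \<le> K \<Longrightarrow> norm A \<le> K"
  unfolding norm_bop.rep_eq by (rule onorm_bound)

lemma norm_bop_le_1_iff: "norm A \<le> 1 \<longleftrightarrow> (\<forall>x. norm (bop_apply A x) \<le> norm x)"
proof
  assume "norm A \<le> 1"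
  then show "\<forall>x. norm (bop_apply A x) \<le> norm x"
    using norm_bop_apply [of A] by (metis mult_left_le_one_le norm_ge_zero order_trans mult.commute)
qed (auto intro: norm_bop_leI [of _ 1])

lemma bop_apply_Bop:
  assumes "semilinear (\<lambda>z. z) f" "\<And>x. norm (f x) \<le> K * norm x"
  shows "bop_apply (Bop f) = f"
proof (rule Bop_inverse)
  have "bounded_linear f"
    by (rule bounded_linear_intro [of _ K])
      (simp_all add: idc.semilinearD [OF assms(1)] assms(2) mult.commute [of _ K])
  then show "f \<in> {f. bounded_clinear f}"
    by (simp add: bounded_clinear_def idc.semilinearD [OF assms(1)])
qed

lemma bop_compose_assoc: "(A o\<^sub>B B) o\<^sub>B C = A o\<^sub>B (B o\<^sub>B C)"
  by (rule bop_eqI) simp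

lemma bop_compose_simps [simp]:
  "bop_id o\<^sub>B A = A" "A o\<^sub>B bop_id = A" "0 o\<^sub>B A = 0" "A o\<^sub>B 0 = 0"
  by (rule bop_eqI; simp add: bop_linear)+

lemma bop_compose_linear:
  "(A + B) o\<^sub>B C = (A o\<^sub>B C) + (B o\<^sub>B C)" "A o\<^sub>B (B + C) = (A o\<^sub>B B) + (A o\<^sub>B C)"
  "(A - B) o\<^sub>B C = (A o\<^sub>B C) - (B o\<^sub>B C)" "A o\<^sub>B (B - C) = (A o\<^sub>B B) - (A o\<^sub>B C)"
  "(c *\<^sub>C A) o\<^sub>B B = c *\<^sub>C (A o\<^sub>B B)" "A o\<^sub>B (c *\<^sub>C B) = c *\<^sub>C (A o\<^sub>B B)"
  "(r *\<^sub>R A) o\<^sub>B B = r *\<^sub>R (A o\<^sub>B B)" "A o\<^sub>B (r *\<^sub>R B) = r *\<^sub>R (A o\<^sub>B B)"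
  by (rule bop_eqI; simp add: bop_linear)+

lemma norm_bop_compose: "norm (A o\<^sub>B B) \<le> norm A * norm B"
proof (rule norm_bop_leI)
  fix x
  have "norm (A (B x)) \<le> norm A * norm (B x)" by (rule norm_bop_apply)
  also have "\<dots> \<le> norm A * (norm B * norm x)" by (intro mult_left_mono norm_bop_apply norm_ge_zero)
  finally show "norm (bop_apply (A o\<^sub>B B) x) \<le> norm A * norm B * norm x" by (simp add: mult.assoc)
qed simp

lemma adj_exists:
  fixes A :: "'a::chilbert_space bop"
  obtains B :: "'a bop" where "linear_adj (bop_apply A) (bop_apply B)" "norm B \<le> norm A"
proof -
  obtain W where W: "linear_adj (bop_apply A) W" "\<And>y. norm (W y) \<le> norm A * norm y"
    using idc.is_adj_exists [OF semilinear_bop norm_bop_apply norm_ge_zero] by blast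
  then have eq: "bop_apply (Bop W) = W" by (metis bop_apply_Bop idc.is_adj_semilinear)
  with W have "norm (Bop W) \<le> norm A" by (intro norm_bop_leI) simp_all
  then show thesis using that W(1) eq by metis
qed

lemma adj_eqI:
  fixes A :: "'a::chilbert_space bop"
  assumes "linear_adj (bop_apply A) (bop_apply B)"
  shows "adj A = B"
  unfolding adj_def
proof (rule the_equality)
  show "\<forall>x y. cinner (A x) y = cinner x (B y)" using assms by (simp add: is_adj_def)
  show "C = B" if "\<forall>x y. cinner (A x) y = cinner x (bop_apply C y)" for C
    using that assms idc.is_adj_unique [of "bop_apply A" "bop_apply C" "bop_apply B"]
    by (auto simp: is_adj_def intro: bop_eqI)
qed

lemma is_adj_adj: "linear_adj (bop_apply A) (bop_apply (adj A))"
  by (metis adj_exists adj_eqI)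

lemmas cinner_adj = idc.is_adjD [OF is_adj_adj]

lemma adj_eqI': "(\<And>x y. cinner (bop_apply A x) y = cinner x (bop_apply B y)) \<Longrightarrow> adj A = B"
  by (rule adj_eqI) (simp add: is_adj_def)

lemma adj_adj [simp]: "adj (adj A) = A"
  by (rule adj_eqI) (rule idc.is_adj_sym [OF is_adj_adj])

lemma adj_simps [simp]:
  "adj (A + B) = adj A + adj B" "adj (A - B) = adj A - adj B" "adj (- A) = - adj A"
  "adj 0 = 0" "adj bop_id = bop_id" "adj (c *\<^sub>C A) = cnj c *\<^sub>C adj A"
  "adj (r *\<^sub>R A) = r *\<^sub>R adj A" "adj (A o\<^sub>B B) = adj B o\<^sub>B adj A"
  by (rule adj_eqI'; simp add: cinner_simps cinner_adj(1))+

lemma norm_adj [simp]: "norm (adj A) = norm A"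
  by (metis adj_exists adj_eqI adj_adj antisym)

lemma isometry_iff: "isometry A \<longleftrightarrow> adj A o\<^sub>B A = bop_id"
proof
  assume "isometry A"
  then have "adj A (A x) = x" for x
    by (intro idc.isometry_adj_left_inverse semilinear_bop is_adj_adj) (simp add: isometry_def)
  then show "adj A o\<^sub>B A = bop_id" by (intro bop_eqI) simp
next
  assume *: "adj A o\<^sub>B A = bop_id"
  have "(norm (A x))\<^sup>2 = (norm x)\<^sup>2" for x
  proof -
    have "cinner (A x) (A x) = cinner x (bop_apply (adj A o\<^sub>B A) x)" by (simp add: cinner_adj(1))
    then show ?thesis unfolding * Re_cinner_self [symmetric] by simp
  qed
  then show "isometry A" by (simp add: isometry_def)
qed

lemma isometryD: "isometry A \<Longrightarrow> norm (bop_apply A x) = norm x"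
  by (simp add: isometry_def)

lemma isometry_cinner: "isometry A \<Longrightarrow> cinner (bop_apply A x) (bop_apply A y) = cinner x y"
  by (rule idc.semilinear_isometry_cinner [OF semilinear_bop]) (simp add: isometry_def)

lemma isometry_adj_apply [simp]: "isometry A \<Longrightarrow> bop_apply (adj A) (bop_apply A x) = x"
  by (metis isometry_iff bop_apply_simps(7,8))

lemma isometry_compose: "isometry A \<Longrightarrow> isometry B \<Longrightarrow> isometry (A o\<^sub>B B)"
  by (simp add: isometry_def)

lemma isometry_id: "isometry bop_id"
  by (simp add: isometry_def)

lemma unitary_iff: "unitary V \<longleftrightarrow> isometry V \<and> isometry (adj V)"
  by (simp add: unitary_def isometry_iff)

lemma isometry_norm_le: "isometry A \<Longrightarrow> norm A \<le> 1"
  by (simp add: norm_bop_le_1_iff isometry_def)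

section \<open>Rank one operators\<close>

lift_definition rank_one :: "'a::chilbert_space \<Rightarrow> 'a \<Rightarrow> 'a bop" is "\<lambda>a b x. cinner x b *\<^sub>C a"
  unfolding bounded_clinear_def
proof (intro conjI allI)
  fix a b :: 'a
  have "norm (cinner x b *\<^sub>C a) \<le> norm x * (norm b * norm a)" for x
    unfolding norm_scaleC mult.assoc [symmetric]
    by (intro mult_right_mono norm_cinner_le norm_ge_zero)
  then show "bounded_linear (\<lambda>x. cinner x b *\<^sub>C a)"
    by (intro bounded_linear_intro)
      (simp_all add: cinner_simps scaleC_add_left scaleC_scaleC scaleR_scaleC)
  show "cinner (c *\<^sub>C x) b *\<^sub>C a = c *\<^sub>C cinner x b *\<^sub>C a" for c x
    by (simp add: cinner_simps scaleC_scaleC)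
qed

lemma rank_one_apply [simp]: "bop_apply (rank_one a b) x = cinner x b *\<^sub>C a"
  by transfer simp

lemma rank_one_simps:
  "adj (rank_one a b) = rank_one b a"
  "A o\<^sub>B rank_one a b = rank_one (A a) b"
  "rank_one a b o\<^sub>B A = rank_one a (adj A b)"
  "rank_one a b o\<^sub>B rank_one c d = cinner c b *\<^sub>C rank_one a d"
  "rank_one (a + a') b = rank_one a b + rank_one a' b"
  "rank_one (k *\<^sub>C a) b = k *\<^sub>C rank_one a b"
proof -
  show "adj (rank_one a b) = rank_one b a"
  proof (rule adj_eqI')
    show "cinner (rank_one a b x) y = cinner x (rank_one b a y)" for x y
      using cinner_commute [of a y] by (simp add: cinner_simps mult.commute)
  qed
qed (rule bop_eqI; simp add: bop_linear cinner_adj(1) cinner_simps scaleC_scaleC scaleC_add_left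
    scaleC_add_right mult.commute)+


section \<open>Extreme points of the unit ball\<close>

definition extreme :: "'a::chilbert_space bop \<Rightarrow> bool" where
  "extreme A \<longleftrightarrow> isometry A \<or> isometry (adj A)"

lemma extreme_adj [simp]: "extreme (adj A) \<longleftrightarrow> extreme A"
  by (auto simp: extreme_def)

lemma extreme_norm_le: "extreme A \<Longrightarrow> norm A \<le> 1"
  unfolding extreme_def using isometry_norm_le by (metis norm_adj)

lemma extreme_point_of_cball_iff:
  "x extreme_point_of cball 0 1 \<longleftrightarrow>
    norm x \<le> 1 \<and> (\<forall>a b. norm a \<le> 1 \<longrightarrow> norm b \<le> 1 \<longrightarrow> x \<notin> open_segment a b)"
  for x :: "'a::real_normed_vector"
  by (auto simp: extreme_point_of_def)

text \<open>Strict convexity of the Hilbert norm: the squared norm of a convex combination falls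
  short of the averaged squared norms by exactly
  \<open>u * (1 - u) * (norm (a - b))\<^sup>2\<close>.\<close>

lemma segment_norm_eq:
  fixes a b x :: "'a::complex_inner"
  assumes x: "x = (1 - u) *\<^sub>R a + u *\<^sub>R b" and u: "0 < u" "u < 1"
    and "norm a \<le> norm x" "norm b \<le> norm x"
  shows "a = b"
proof -
  have "(norm x)\<^sup>2 = (1 - u) * (norm a)\<^sup>2 + u * (norm b)\<^sup>2 - u * (1 - u) * (norm (a - b))\<^sup>2"
    unfolding x norm_diff_sq norm_add_sq
    by (simp add: cinner_simps power_mult_distrib) (simp add: power2_eq_square algebra_simps)
  moreover have "(1 - u) * (norm a)\<^sup>2 \<le> (1 - u) * (norm x)\<^sup>2" "u * (norm b)\<^sup>2 \<le> u * (norm x)\<^sup>2"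
    using assms by (auto intro!: mult_left_mono power_mono)
  ultimately have "u * (1 - u) * (norm (a - b))\<^sup>2 \<le> 0" by (simp add: algebra_simps)
  then show ?thesis using u by (simp add: mult_le_0_iff)
qed

text \<open>At every \<open>x\<close> the endpoints of the segment have norm at most
  \<open>norm x = norm (A x)\<close>, so strict convexity makes them agree there.\<close>

lemma isometry_imp_extreme_point:
  fixes A :: "'a::chilbert_space bop"
  assumes A: "isometry A"
  shows "A extreme_point_of cball 0 1"
  unfolding extreme_point_of_cball_iff
proof (intro conjI allI impI notI)
  fix B C assume BC: "norm B \<le> 1" "norm C \<le> 1" and seg: "A \<in> open_segment B C"
  then obtain u where u: "B \<noteq> C" "0 < u" "u < 1" "A = (1 - u) *\<^sub>R B + u *\<^sub>R C"
    by (auto simp: in_segment)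
  have "B x = C x" for x
    by (rule segment_norm_eq [of "A x" u])
      (use BC u A in \<open>auto simp: norm_bop_le_1_iff isometry_def\<close>)
  with u(1) show False using bop_eqI by blast
qed (rule isometry_norm_le [OF A])

text \<open>\<open>adj\<close> is a real-linear isometric involution; this carries the result on
  isometries over to coisometries.\<close>

lemma extreme_point_adj:
  fixes A :: "'a::chilbert_space bop"
  assumes A: "A extreme_point_of cball 0 1"
  shows "adj A extreme_point_of cball 0 1"
  unfolding extreme_point_of_cball_iff
proof (intro conjI allI impI notI)
  show "norm (adj A) \<le> 1" using A by (simp add: extreme_point_of_cball_iff)
  fix B C assume BC: "norm B \<le> 1" "norm C \<le> 1" and seg: "adj A \<in> open_segment B C"
  then obtain u where u: "B \<noteq> C" "0 < u" "u < 1" "adj A = (1 - u) *\<^sub>R B + u *\<^sub>R C"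
    by (auto simp: in_segment)
  have "A = (1 - u) *\<^sub>R adj B + u *\<^sub>R adj C"
    using arg_cong [OF u(4), of adj] by simp
  moreover have "adj B \<noteq> adj C" using u(1) adj_adj by metis
  ultimately have "A \<in> open_segment (adj B) (adj C)" using u by (auto simp: in_segment)
  moreover have "norm (adj B) \<le> 1" "norm (adj C) \<le> 1" using BC by simp_all
  ultimately show False using A by (auto simp: extreme_point_of_cball_iff)
qed

text \<open>If \<open>A\<close> is neither an isometry nor a coisometry, then \<open>1 - A\<^sup>*A\<close> and \<open>1 - AA\<^sup>*\<close> are nonzero
  and \<open>A\<close> is the midpoint of \<open>A \<plusminus> (1 - AA\<^sup>*) Z (1 - A\<^sup>*A)\<close> for a small rank one operator \<open>Z\<close>.\<close>

lemma defect_perturbation: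
  fixes A :: "'a::chilbert_space bop" and u v :: 'a
  assumes A: "norm A \<le> 1" and u: "norm u \<le> 1" and v: "norm v \<le> 1" and s: "cmod s \<le> 1/3"
  shows "norm (A + s *\<^sub>C rank_one (u - A (adj A u)) (v - adj A (A v))) \<le> 1"
  unfolding norm_bop_le_1_iff
proof
  fix x
  define d where "d = x - adj A (A x)"
  define w where "w = u - A (adj A u)"
  have A1: "norm (A y) \<le> norm y" "norm (adj A y) \<le> norm y" for y
    using A norm_bop_le_1_iff [of A] norm_bop_le_1_iff [of "adj A"] by auto
  \<comment> \<open>Used twice: for \<open>A\<close> at \<open>x\<close> to bound \<open>d\<close>,
    and for \<open>adj A\<close> at \<open>u\<close> to bound \<open>w\<close>.\<close>
  have defect: "(norm (y - adj B (B y)))\<^sup>2 \<le> (norm y)\<^sup>2 - (norm (B y))\<^sup>2"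
    if B: "norm B \<le> 1" for B :: "'a bop" and y
  proof -
    have "Re (cinner y (adj B (B y))) = (norm (B y))\<^sup>2"
      by (simp add: cinner_adj(1) [symmetric] Re_cinner_self)
    moreover have "(norm (adj B (B y)))\<^sup>2 \<le> (norm (B y))\<^sup>2"
      using B norm_bop_le_1_iff [of "adj B"] by (intro power_mono) auto
    ultimately show ?thesis by (simp add: norm_diff_sq)
  qed
  have d: "(norm d)\<^sup>2 \<le> (norm x)\<^sup>2 - (norm (A x))\<^sup>2"
    unfolding d_def by (rule defect [OF A])
  have "(norm w)\<^sup>2 \<le> (norm u)\<^sup>2"
    using defect [of "adj A" u] A unfolding w_def by (simp add: order_trans)
  then have w: "norm w \<le> 1" using u by (metis norm_ge_zero order_trans power2_le_imp_le)
  define k where "k = s * cinner d v"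
  have "cmod (cinner d v) \<le> norm d * 1"
    using v order_trans [OF norm_cinner_le mult_left_mono] by (metis norm_ge_zero)
  then have k: "cmod k \<le> norm d / 3"
    unfolding k_def norm_mult using mult_mono [OF s, of "cmod (cinner d v)" "norm d"] by simp
  have eq: "bop_apply (A + s *\<^sub>C rank_one w (v - adj A (A v))) x = A x + k *\<^sub>C w"
    by (simp add: d_def k_def cinner_simps scaleC_scaleC cinner_adj(1))
  \<comment> \<open>\<open>A\<close> intertwines the two defects,
    \<open>A (1 - adj A A) = (1 - A adj A) A\<close>; this makes the cross term quadratic in
    \<open>d\<close>.\<close>
  have "cinner (A x) w = cinner (A d) u"
    by (simp add: w_def d_def cinner_simps bop_linear cinner_adj(1))
  then have "Re (cinner (A x) (k *\<^sub>C w)) \<le> cmod k * cmod (cinner (A d) u)"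
    using complex_Re_le_cmod by (metis cinner_scaleC_right complex_mod_cnj norm_mult)
  also have "\<dots> \<le> norm d / 3 * norm d"
  proof (rule mult_mono [OF k])
    have "cmod (cinner (A d) u) \<le> norm (A d) * norm u" by (rule norm_cinner_le)
    also have "\<dots> \<le> norm d * 1" using u A1 by (intro mult_mono) auto
    finally show "cmod (cinner (A d) u) \<le> norm d" by simp
  qed auto
  finally have cross: "Re (cinner (A x) (k *\<^sub>C w)) \<le> (norm d)\<^sup>2 / 3" by (simp add: power2_eq_square)
  have "norm (k *\<^sub>C w) \<le> norm d / 3 * 1"
    unfolding norm_scaleC using k w by (intro mult_mono) auto
  then have "(norm (k *\<^sub>C w))\<^sup>2 \<le> (norm d / 3)\<^sup>2" by (intro power_mono) auto
  then have "(norm (k *\<^sub>C w))\<^sup>2 \<le> (norm d)\<^sup>2 / 9" by (simp add: power_divide)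
  \<comment> \<open>The radius \<open>1/3\<close> adds at most \<open>1/9 + 2/3\<close> of
    \<open>(norm d)\<^sup>2\<close>, less than the gap between \<open>(norm (A x))\<^sup>2\<close>
    and \<open>(norm x)\<^sup>2\<close>.\<close>
  then have "(norm (A x + k *\<^sub>C w))\<^sup>2 \<le> (norm x)\<^sup>2"
    unfolding norm_add_sq using cross d zero_le_power2 [of "norm d"] by linarith
  then show "norm (bop_apply (A + s *\<^sub>C rank_one (u - A (adj A u)) (v - adj A (A v))) x) \<le> norm x"
    unfolding w_def [symmetric] eq by (simp add: power2_le_iff_abs_le)
qed

lemma extreme_point_imp_extreme:
  fixes A :: "'a::chilbert_space bop"
  assumes A: "A extreme_point_of cball 0 1"
  shows "extreme A"
proof (rule ccontr)
  assume "\<not> extreme A"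
  then have "adj A o\<^sub>B A \<noteq> bop_id" "A o\<^sub>B adj A \<noteq> bop_id"
    by (auto simp: extreme_def isometry_iff)
  then obtain v u where "adj A (A v) \<noteq> v" "A (adj A u) \<noteq> u"
    using bop_eqI [of "adj A o\<^sub>B A" bop_id] bop_eqI [of "A o\<^sub>B adj A" bop_id] by auto
  \<comment> \<open>Normalised because \<open>defect_perturbation\<close> requires vectors of norm
    at most 1; the defects stay nonzero.\<close>
  then have v: "sgn v - adj A (A (sgn v)) \<noteq> 0" and u: "sgn u - A (adj A (sgn u)) \<noteq> 0"
    by (auto simp: sgn_div_norm bop_linear bop_linear(6) [of _ _ v] scaleR_diff_right [symmetric])
  define B where "B = rank_one (sgn u - A (adj A (sgn u))) (sgn v - adj A (A (sgn v)))"
  have "norm A \<le> 1" using A by (simp add: extreme_point_of_cball_iff)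
  then have n: "norm (A + s *\<^sub>C B) \<le> 1" if "cmod s \<le> 1/3" for s
    unfolding B_def by (rule defect_perturbation) (use that in \<open>auto simp: norm_sgn\<close>)
  have "B (sgn v - adj A (A (sgn v))) \<noteq> 0"
    using u v by (simp add: B_def cinner_self complex_vector.scale_eq_0_iff)
  then have B0: "B \<noteq> 0" by auto
  define C where "C = (1/3) *\<^sub>C B"
  have C0: "C \<noteq> 0" using B0 by (simp add: C_def complex_vector.scale_eq_0_iff)
  have "A = midpoint (A + C) (A - C)" by (simp add: midpoint_def flip: scaleR_2)
  moreover have "A + C \<noteq> A - C"
  proof
    assume "A + C = A - C"
    then have "2 *\<^sub>R C = 0" by (simp add: scaleR_2 eq_neg_iff_add_eq_0)
    then show False using C0 by simp
  qed
  ultimately have "A \<in> open_segment (A + C) (A - C)" by (metis midpoint_in_open_segment)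
  moreover have "norm (A + C) \<le> 1" "norm (A - C) \<le> 1"
    using n [of "1/3"] n [of "- (1/3)"] by (simp_all add: C_def complex_vector.scale_minus_left)
  ultimately show False using A by (auto simp: extreme_point_of_cball_iff)
qed

lemma extreme_point_iff_extreme: "A extreme_point_of cball 0 1 \<longleftrightarrow> extreme A"
  using extreme_point_imp_extreme isometry_imp_extreme_point extreme_point_adj
  by (metis adj_adj extreme_def)

section \<open>Unitaries span the operators\<close>

text \<open>Inherited from the Banach space of real bounded linear maps: the embedding is isometric,
  and complex homogeneity passes to pointwise limits. Completeness serves the fixed point argument
  below.\<close>

instance bop :: (chilbert_space) complete_space
proof
  fix X :: "nat \<Rightarrow> 'a bop" assume X: "Cauchy X"
  define Y where "Y n = Blinfun (bop_apply (X n))" for n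
  have Y: "blinfun_apply (Y n) = bop_apply (X n)" for n
    unfolding Y_def by (rule bounded_linear_Blinfun_apply [OF bounded_linear_bop])
  have dist_eq: "dist (Y m) (Y n) = dist (X m) (X n)" for m n
    by (simp add: dist_norm norm_blinfun.rep_eq norm_bop.rep_eq Y minus_blinfun.rep_eq minus_bop.rep_eq)
  have "Cauchy Y" using X by (simp add: Cauchy_def dist_eq)
  then obtain L where L: "Y \<longlonglongrightarrow> L" using Cauchy_convergent convergent_def by blast
  have lim: "(\<lambda>n. bop_apply (X n) x) \<longlonglongrightarrow> blinfun_apply L x" for x
    using blinfun.tendsto [OF L tendsto_const, of x] by (simp add: Y)
  have hom: "blinfun_apply L (c *\<^sub>C x) = c *\<^sub>C blinfun_apply L x" for c x
  proof (rule LIMSEQ_unique [OF lim])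
    show "(\<lambda>n. bop_apply (X n) (c *\<^sub>C x)) \<longlonglongrightarrow> c *\<^sub>C blinfun_apply L x"
      unfolding bop_linear by (rule bounded_linear.tendsto [OF bounded_linear_scaleC_right lim])
  qed
  have B: "bop_apply (Bop (blinfun_apply L)) = blinfun_apply L"
    by (rule Bop_inverse) (simp add: bounded_clinear_def hom blinfun.bounded_linear_right)
  have "dist (X n) (Bop (blinfun_apply L)) = dist (Y n) L" for n
    by (simp add: dist_norm norm_blinfun.rep_eq norm_bop.rep_eq Y minus_blinfun.rep_eq minus_bop.rep_eq B)
  then have "X \<longlonglongrightarrow> Bop (blinfun_apply L)"
    using L by (simp add: tendsto_iff)
  then show "convergent X" by (auto simp: convergent_def)
qed

lemma bounded_linear_adj: "bounded_linear (adj :: 'a::chilbert_space bop \<Rightarrow> 'a bop)"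
  by (rule bounded_linear_intro [of _ 1]) simp_all

lemma bounded_linear_compose_left: "bounded_linear (\<lambda>X :: 'a::chilbert_space bop. X o\<^sub>B A)"
  by (rule bounded_linear_intro [of _ "norm A"]) (simp_all add: bop_compose_linear norm_bop_compose)

lemma bounded_linear_compose_right: "bounded_linear (\<lambda>X :: 'a::chilbert_space bop. A o\<^sub>B X)"
  by (rule bounded_linear_intro [of _ "norm A"])
    (simp_all add: bop_compose_linear norm_bop_compose mult.commute [of _ "norm A"])

text \<open>The root is \<open>1 - Y\<close>, where \<open>Y\<close> is the fixed point of the contraction
  \<open>Y \<mapsto> (T\<^sup>2 + Y\<^sup>2) / 2\<close> of the ball of radius \<open>1/2\<close>.\<close>

lemma sqrt_one_minus_square:
  fixes T :: "'a::chilbert_space bop"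
  assumes T: "adj T = T" and norm: "norm T \<le> 1/2"
  obtains C where "adj C = C" "C o\<^sub>B T = T o\<^sub>B C" "(C o\<^sub>B C) + (T o\<^sub>B T) = bop_id"
proof -
  define f where "f Y = (1/2) *\<^sub>R ((T o\<^sub>B T) + (Y o\<^sub>B Y))" for Y
  \<comment> \<open>\<open>S\<close> carries self-adjointness and commutation with \<open>T\<close>
    along as closed conditions, so that the fixed point inherits them.\<close>
  define S where "S = {Y. norm Y \<le> 1/2} \<inter> {Y. adj Y = Y} \<inter> {Y. Y o\<^sub>B T = T o\<^sub>B Y}"
  have "closed S"
    unfolding S_def
    by (intro closed_Int closed_Collect_eq closed_Collect_le continuous_intros linear_continuous_on
        bounded_linear_adj bounded_linear_compose_left bounded_linear_compose_right)
  then have "complete S" by (simp add: complete_eq_closed)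
  have maps: "f Y \<in> S" if Y: "Y \<in> S" for Y
  proof -
    have Y': "norm Y \<le> 1/2" "adj Y = Y" and comm: "Y o\<^sub>B T = T o\<^sub>B Y" using Y by (auto simp: S_def)
    have sq: "norm (Z o\<^sub>B Z) \<le> 1/4" if "norm Z \<le> 1/2" for Z :: "'a bop"
      using order_trans [OF norm_bop_compose mult_mono [OF that that]] by simp
    have "norm ((T o\<^sub>B T) + (Y o\<^sub>B Y)) \<le> 1/4 + 1/4"
      by (intro norm_triangle_mono sq norm Y')
    then have "norm (f Y) \<le> 1/2" by (simp add: f_def)
    moreover have "adj (f Y) = f Y" by (simp add: f_def T Y')
    moreover have "(Y o\<^sub>B Y) o\<^sub>B T = T o\<^sub>B (Y o\<^sub>B Y)" by (metis comm bop_compose_assoc)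
    then have "f Y o\<^sub>B T = T o\<^sub>B f Y" by (simp add: f_def bop_compose_linear bop_compose_assoc)
    ultimately show ?thesis by (simp add: S_def)
  qed
  have contr: "dist (f Y) (f Z) \<le> 1/2 * dist Y Z" if YZ: "Y \<in> S" "Z \<in> S" for Y Z
  proof -
    have "f Y - f Z = (1/2) *\<^sub>R ((Y o\<^sub>B Y) - (Z o\<^sub>B Z))"
      by (simp add: f_def flip: scaleR_diff_right)
    \<comment> \<open>A noncommutative difference of squares; both factors have norm at most
      \<open>1/2\<close>, whence the Lipschitz constant \<open>1/2\<close>.\<close>
    also have "(Y o\<^sub>B Y) - (Z o\<^sub>B Z) = (Y o\<^sub>B (Y - Z)) + ((Y - Z) o\<^sub>B Z)"
      by (simp add: bop_compose_linear)
    finally have "norm (f Y - f Z) = 1/2 * norm ((Y o\<^sub>B (Y - Z)) + ((Y - Z) o\<^sub>B Z))"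
      by simp
    also have "\<dots> \<le> 1/2 * (norm Y * norm (Y - Z) + norm (Y - Z) * norm Z)"
      by (intro mult_left_mono norm_triangle_mono norm_bop_compose) simp
    also have "\<dots> \<le> 1/2 * (1/2 * norm (Y - Z) + norm (Y - Z) * (1/2))"
      using YZ by (intro mult_left_mono add_mono mult_right_mono) (auto simp: S_def)
    finally show ?thesis by (simp add: dist_norm)
  qed
  have "0 \<in> S" by (simp add: S_def)
  have "\<exists>!Y\<in>S. f Y = Y"
    by (rule Banach_fix [where c = "1/2"])
      (use \<open>complete S\<close> \<open>0 \<in> S\<close> maps contr in auto)
  then obtain Y where Y: "Y \<in> S" "f Y = Y" by metis
  \<comment> \<open>The fixed point equation is \<open>2 Y = T\<^sup>2 + Y\<^sup>2\<close>, that is,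
    \<open>(1 - Y)\<^sup>2 + T\<^sup>2 = 1\<close>.\<close>
  have "T o\<^sub>B T = 2 *\<^sub>R Y - (Y o\<^sub>B Y)"
    using arg_cong [OF Y(2), of "\<lambda>X. 2 *\<^sub>R X"] by (simp add: f_def algebra_simps)
  then have "((bop_id - Y) o\<^sub>B (bop_id - Y)) + (T o\<^sub>B T) = bop_id"
    by (simp add: bop_compose_linear scaleR_2)
  moreover have "adj (bop_id - Y) = bop_id - Y" "(bop_id - Y) o\<^sub>B T = T o\<^sub>B (bop_id - Y)"
    using Y(1) by (simp_all add: S_def bop_compose_linear)
  ultimately show thesis using that by blast
qed

text \<open>A small self-adjoint \<open>T\<close> is half the difference of the unitaries
  \<open>C + \<i> T\<close> and \<open>C - \<i> T\<close> divided by \<open>\<i>\<close>. Scaling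
  gives all self-adjoint operators, and \<open>A + adj A\<close> and \<open>\<i> (A - adj A)\<close>
  give the rest. Linear or semilinear identities thus need checking on unitaries only.\<close>

lemma bop_unitary_induct [case_names unitary add scaleC]:
  fixes A :: "'a::chilbert_space bop"
  assumes unitary: "\<And>U. unitary U \<Longrightarrow> P U"
    and add: "\<And>A B. P A \<Longrightarrow> P B \<Longrightarrow> P (A + B)"
    and scale: "\<And>c A. P A \<Longrightarrow> P (c *\<^sub>C A)"
  shows "P A"
proof -
  have small: "P T" if T: "adj T = T" "norm T \<le> 1/2" for T
  proof -
    obtain C where C: "adj C = C" "C o\<^sub>B T = T o\<^sub>B C" "(C o\<^sub>B C) + (T o\<^sub>B T) = bop_id"
      using sqrt_one_minus_square [OF T] by blast
    have P: "P (C + s *\<^sub>C T)" if s: "s = \<i> \<or> s = - \<i>" for s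
    proof (rule unitary)
      have s': "cnj s = - s" "s * s = - 1" using s by auto
      have "((C + s *\<^sub>C T) o\<^sub>B (C - s *\<^sub>C T)) = (C o\<^sub>B C) + (T o\<^sub>B T)"
           "((C - s *\<^sub>C T) o\<^sub>B (C + s *\<^sub>C T)) = (C o\<^sub>B C) + (T o\<^sub>B T)"
        by (simp_all add: bop_compose_linear scaleC_add_right complex_vector.scale_right_diff_distrib
            scaleC_scaleC s' C(2) complex_vector.scale_minus_left scaleC_one)
      then show "unitary (C + s *\<^sub>C T)"
        by (simp add: unitary_def C T s' complex_vector.scale_minus_left)
    qed
    have "T = (1 / (2 * \<i>)) *\<^sub>C ((C + \<i> *\<^sub>C T) + (- 1) *\<^sub>C (C + (- \<i>) *\<^sub>C T))"
      by (simp add: scaleC_add_right scaleC_scaleC flip: scaleC_add_left)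
    then show ?thesis using add scale P by metis
  qed
  have self: "P T" if T: "adj T = T" for T
  proof -
    \<comment> \<open>This gives \<open>norm (r *\<^sub>R T) \<le> 1/2\<close> and is defined also
      for \<open>T = 0\<close>.\<close>
    define r where "r = 1 / (2 * norm T + 1)"
    have r: "r > 0" by (simp add: r_def add_nonneg_pos)
    have "P (r *\<^sub>R T)"
      using T r by (intro small) (simp_all add: r_def field_simps)
    then have "P (complex_of_real (1 / r) *\<^sub>C r *\<^sub>R T)" by (rule scale)
    moreover have "complex_of_real (1 / r) *\<^sub>C r *\<^sub>R T = T"
      using r by (simp only: scaleR_scaleC [symmetric]) simp
    ultimately show ?thesis by simp
  qed
  have "(A + adj A) + (- \<i>) *\<^sub>C (\<i> *\<^sub>C (A - adj A)) = 2 *\<^sub>R A"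
    by (simp add: scaleC_scaleC scaleC_one scaleR_2)
  moreover have "A = (1/2) *\<^sub>C 2 *\<^sub>R A"
    by (simp add: scaleR_scaleC scaleC_scaleC scaleC_one)
  moreover have "P (A + adj A)" "P (\<i> *\<^sub>C (A - adj A))"
    by (rule self; simp add: add.commute complex_vector.scale_minus_left complex_vector.scale_right_diff_distrib)+
  ultimately show ?thesis using add scale by metis
qed

section \<open>Orthogonal families\<close>

lemma norm_eq_1I:
  assumes "cinner x x = 1"
  shows "norm x = 1"
proof -
  have "(norm x)\<^sup>2 = 1\<^sup>2" using Re_cinner_self [of x] assms by simp
  then show ?thesis by (rule power2_eq_imp_eq) simp_all
qed

lemma cinner_sum_left: "cinner (sum f F) y = (\<Sum>i\<in>F. cinner (f i) y)"
  for y :: "'a::complex_inner"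
  by (induction F rule: infinite_finite_induct) (simp_all add: cinner_simps)

lemma norm_sum_orthogonal:
  fixes v :: "'i \<Rightarrow> 'a::complex_inner"
  assumes "pairwise (\<lambda>i j. cinner (v i) (v j) = 0) F"
  shows "(norm (\<Sum>i\<in>F. v i))\<^sup>2 = (\<Sum>i\<in>F. (norm (v i))\<^sup>2)"
  using assms
proof (induction F rule: infinite_finite_induct)
  case (insert i F)
  have "cinner (\<Sum>j\<in>F. v j) (v i) = 0"
    using insert by (auto simp: cinner_sum_left pairwise_insert intro!: sum.neutral)
  then have "cinner (v i) (\<Sum>j\<in>F. v j) = 0" by (subst cinner_commute) simp
  then show ?case using insert by (simp add: norm_add_sq pairwise_insert)
qed simp_all

text \<open>By \<open>proj\<close>, each \<open>v i\<close> is orthogonal to \<open>x - v i\<close>.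
  The sum inherits this, so \<open>(norm x)\<^sup>2 - (norm (sum v F))\<^sup>2\<close> is a squared
  distance. This form covers both Fourier terms and projections onto ranges.\<close>

lemma bessel:
  fixes v :: "'i \<Rightarrow> 'a::complex_inner"
  assumes orth: "pairwise (\<lambda>i j. cinner (v i) (v j) = 0) F"
    and proj: "\<And>i. i \<in> F \<Longrightarrow> cinner (v i) x = complex_of_real ((norm (v i))\<^sup>2)"
  shows "(\<Sum>i\<in>F. (norm (v i))\<^sup>2) \<le> (norm x)\<^sup>2"
proof -
  have "cinner (sum v F) x = complex_of_real ((norm (sum v F))\<^sup>2)"
    unfolding norm_sum_orthogonal [OF orth] cinner_sum_left of_real_sum
    by (rule sum.cong [OF refl proj])
  then have "(norm (sum v F - x))\<^sup>2 = (norm x)\<^sup>2 - (norm (sum v F))\<^sup>2"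
    by (simp add: norm_diff_sq)
  then show ?thesis
    unfolding norm_sum_orthogonal [OF orth] by (metis diff_ge_0_iff_ge zero_le_power2)
qed

text \<open>By Pythagoras, increments of the partial sums have squared norms equal to increments of
  a convergent real sum, so the net is Cauchy.\<close>

lemma orthogonal_summable_on:
  fixes v :: "'i \<Rightarrow> 'a::chilbert_space"
  assumes orth: "pairwise (\<lambda>i j. cinner (v i) (v j) = 0) I"
    and bound: "\<And>F. finite F \<Longrightarrow> F \<subseteq> I \<Longrightarrow> (\<Sum>i\<in>F. (norm (v i))\<^sup>2) \<le> K"
  shows "v summable_on I"
proof -
  let ?n = "\<lambda>F. \<Sum>i\<in>F. (norm (v i))\<^sup>2"
  have "(\<lambda>i. (norm (v i))\<^sup>2) summable_on I"
    by (rule nonneg_bdd_above_summable_on) (auto intro!: bdd_aboveI2 [of _ _ K] bound)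
  then obtain s where s: "(?n \<longlongrightarrow> s) (finite_subsets_at_top I)"
    by (auto simp: summable_on_def has_sum_def)
  have "\<exists>P. eventually P (finite_subsets_at_top I) \<and>
      (\<forall>F F'. P F \<and> P F' \<longrightarrow> dist (sum v F) (sum v F') < e)" if e: "e > 0" for e
  proof -
    \<comment> \<open>Two real partial sums within \<open>d\<close> of \<open>s\<close> differ by
      less than \<open>2 * d = (e / 2)\<^sup>2\<close>.\<close>
    define d where "d = (e / 2)\<^sup>2 / 2"
    have d: "d > 0" using e by (simp add: d_def)
    obtain F0 where F0: "finite F0" "F0 \<subseteq> I"
      and near: "\<And>F. finite F \<Longrightarrow> F0 \<subseteq> F \<Longrightarrow> F \<subseteq> I \<Longrightarrow> dist (?n F) s < d"
      using tendstoD [OF s d] by (auto simp: eventually_finite_subsets_at_top)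
    have half: "norm (sum v F - sum v F0) < e / 2" if F: "finite F" "F0 \<subseteq> F" "F \<subseteq> I" for F
    proof -
      have "sum v F - sum v F0 = sum v (F - F0)"
        using F by (simp add: sum_diff)
      then have "(norm (sum v F - sum v F0))\<^sup>2 = ?n (F - F0)"
        by (simp add: norm_sum_orthogonal pairwise_subset [OF orth] F(3) subset_iff [THEN iffD2] Diff_subset [THEN order_trans])
      also have "\<dots> = ?n F - ?n F0" using F by (simp add: sum_diff)
      also have "\<dots> < (e / 2)\<^sup>2"
        using near [OF F] near [OF F0(1) order_refl F0(2)] unfolding dist_real_def d_def by linarith
      finally show ?thesis by (rule power2_less_imp_less) (use e in simp)
    qed
    define P where "P F \<longleftrightarrow> finite F \<and> F0 \<subseteq> F \<and> F \<subseteq> I" for F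
    have "dist (sum v F) (sum v F') < e" if "P F" "P F'" for F F'
    proof (rule dist_triangle_half_r)
      show "dist (sum v F0) (sum v F) < e / 2"
        using half [of F] that(1) by (simp add: P_def dist_norm norm_minus_commute)
      show "dist (sum v F0) (sum v F') < e / 2"
        using half [of F'] that(2) by (simp add: P_def dist_norm norm_minus_commute)
    qed
    moreover have "eventually P (finite_subsets_at_top I)"
      unfolding eventually_finite_subsets_at_top P_def using F0 by (intro exI [of _ F0]) simp
    ultimately show ?thesis by (intro exI [of _ P]) simp
  qed
  then have "cauchy_filter (filtermap (sum v) (finite_subsets_at_top I))"
    by (simp add: cauchy_filter_metric_filtermap)
  moreover have "complete (UNIV :: 'a set)" by (rule complete_UNIV)
  ultimately obtain l where "(sum v \<longlongrightarrow> l) (finite_subsets_at_top I)"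
    using complete_uniform [where S = "UNIV :: 'a set"] by (force simp: filterlim_def)
  then show ?thesis by (auto simp: summable_on_def has_sum_def)
qed

lemma has_sum_norm_sq:
  fixes v :: "'i \<Rightarrow> 'a::complex_inner"
  assumes orth: "pairwise (\<lambda>i j. cinner (v i) (v j) = 0) I" and s: "(v has_sum s) I"
  shows "((\<lambda>i. (norm (v i))\<^sup>2) has_sum (norm s)\<^sup>2) I"
proof -
  have "((\<lambda>F. (norm (sum v F))\<^sup>2) \<longlongrightarrow> (norm s)\<^sup>2) (finite_subsets_at_top I)"
    using s unfolding has_sum_def by (intro tendsto_intros)
  moreover have "eventually (\<lambda>F. (norm (sum v F))\<^sup>2 = (\<Sum>i\<in>F. (norm (v i))\<^sup>2)) (finite_subsets_at_top I)"
    by (rule eventually_finite_subsets_at_top_weakI)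
      (intro norm_sum_orthogonal pairwise_subset [OF orth])
  ultimately show ?thesis
    unfolding has_sum_def by (rule Lim_transform_eventually)
qed

lemma has_sum_cinner_left: "(v has_sum s) I \<Longrightarrow> ((\<lambda>i. cinner (v i) y) has_sum cinner s y) I"
  by (rule has_sum_bounded_linear [OF bounded_linear_cinner_left])

section \<open>Orthonormal bases and the isometries they define\<close>

definition orthonormal :: "'a::complex_inner set \<Rightarrow> bool" where
  "orthonormal B \<longleftrightarrow> (\<forall>x\<in>B. norm x = 1) \<and> pairwise (\<lambda>x y. cinner x y = 0) B"

text \<open>Zorn; scaling keeps \<open>sgn x\<close> in \<open>K\<close>, so a nonzero vector of
  \<open>K\<close> orthogonal to \<open>B\<close> would enlarge \<open>B\<close>. It is applied to
  the whole space and to the range of a projection.\<close>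

lemma maximal_orthonormal:
  fixes K :: "'a::complex_inner set"
  assumes K: "\<And>r x. x \<in> K \<Longrightarrow> r *\<^sub>R x \<in> K"
  obtains B where "B \<subseteq> K" "orthonormal B" "\<And>x. x \<in> K \<Longrightarrow> (\<And>b. b \<in> B \<Longrightarrow> cinner x b = 0) \<Longrightarrow> x = 0"
proof -
  let ?A = "{B. B \<subseteq> K \<and> orthonormal B}"
  have "\<exists>B\<in>?A. \<forall>X\<in>?A. B \<subseteq> X \<longrightarrow> X = B"
  proof (rule subset_Zorn')
    fix C assume "subset.chain ?A C"
    then have C: "C \<subseteq> ?A" and chain: "chain\<^sub>\<subseteq> C"
      unfolding subset_chain_def chain_subset_def by blast+
    have "pairwise (\<lambda>x y. cinner x y = 0) (\<Union>C)"
      by (rule pairwise_chain_Union [OF _ chain]) (use C in \<open>auto simp: orthonormal_def\<close>)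
    then show "\<Union>C \<in> ?A" using C by (auto simp: orthonormal_def)
  qed
  then obtain B where "B \<in> ?A" and max: "\<forall>X\<in>?A. B \<subseteq> X \<longrightarrow> X = B" by (elim bexE)
  then have B: "B \<subseteq> K" "orthonormal B" by simp_all
  have "x = 0" if x: "x \<in> K" "\<And>b. b \<in> B \<Longrightarrow> cinner x b = 0" for x
  proof (rule ccontr)
    assume "x \<noteq> 0"
    have xb: "cinner (sgn x) b = 0" if "b \<in> B" for b
      using x(2) [OF that] by (simp add: sgn_div_norm cinner_simps)
    have "orthonormal (insert (sgn x) B)"
      using B(2) xb \<open>x \<noteq> 0\<close> cinner_commute [of _ "sgn x"]
      by (auto simp: orthonormal_def pairwise_insert norm_sgn)
    moreover have "insert (sgn x) B \<subseteq> K" using B(1) K [OF x(1)] by (simp add: sgn_div_norm)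
    ultimately have "insert (sgn x) B = B" using max by (simp add: subset_insertI)
    then have "sgn x \<in> B" by blast
    then have "cinner (sgn x) (sgn x) = 0" by (rule xb)
    then show False using \<open>x \<noteq> 0\<close> cinner_eq_zeroI sgn_zero_iff by metis
  qed
  then show thesis by (rule that [OF B])
qed

text \<open>Points of a countable dense set chosen within \<open>d / 2\<close> of the members of
  \<open>D\<close> are distinct.\<close>

lemma separated_countable:
  fixes D :: "'a::metric_space set"
  assumes sep: "separable_space (euclidean :: 'a topology)" and d: "d > 0"
    and D: "\<And>x y. x \<in> D \<Longrightarrow> y \<in> D \<Longrightarrow> x \<noteq> y \<Longrightarrow> d \<le> dist x y"
  shows "countable D"
proof -
  obtain C :: "'a set" where C: "countable C" "closure C = UNIV"
    using sep by (auto simp: separable_space_def)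
  have "\<exists>c\<in>C. dist c x < d / 2" for x
    using C(2) closure_approachable [of x C] half_gt_zero [OF d] by blast
  then obtain c where c: "\<And>x. c x \<in> C" "\<And>x. dist (c x) x < d / 2" by metis
  have "inj_on c D"
  proof (rule inj_onI, rule ccontr)
    fix x y assume xy: "x \<in> D" "y \<in> D" "c x = c y" "x \<noteq> y"
    have "dist x y < d"
      using dist_triangle_half_r [of "c x" x d y] c(2) [of x] c(2) [of y] xy(3) by simp
    with D xy show False by force
  qed
  moreover have "countable (c ` D)" by (rule countable_subset [OF _ C(1)]) (use c in auto)
  ultimately show ?thesis using countable_image_inj_on by blast
qed

lemma dist_orthogonal:
  fixes x y :: "'a::complex_inner"
  assumes "cinner x y = 0"
  shows "norm x \<le> dist x y"
proof -
  have "(norm x)\<^sup>2 \<le> (dist x y)\<^sup>2" using assms by (simp add: dist_norm norm_diff_sq)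
  then show ?thesis by (rule power2_le_imp_le) simp
qed

text \<open>Completeness is expressed by a trivial orthogonal complement, not by density of the
  span.\<close>

definition onb :: "(nat \<Rightarrow> 'a::complex_inner) \<Rightarrow> bool" where
  "onb e \<longleftrightarrow> (\<forall>m n. cinner (e m) (e n) = (if m = n then 1 else 0)) \<and>
    (\<forall>x. (\<forall>n. cinner x (e n) = 0) \<longrightarrow> x = 0)"

text \<open>Orthonormal vectors are at distance at least 1, so separability makes a maximal
  orthonormal set countable; if it were finite, finite Fourier expansions would show that it
  spans.\<close>

lemma onb_exists:
  assumes sep: "separable_space (euclidean :: 'a::chilbert_space topology)"
    and inf: "infinite_cdim TYPE('a::chilbert_space)"
  obtains e :: "nat \<Rightarrow> 'a::chilbert_space" where "onb e"
proof -
  obtain B :: "'a set" where B: "orthonormal B"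
    and complete: "\<And>x. (\<And>b. b \<in> B \<Longrightarrow> cinner x b = 0) \<Longrightarrow> x = 0"
    using maximal_orthonormal [of "UNIV :: 'a set"] by auto
  have B1: "cinner b b = 1" if "b \<in> B" for b
    using B that by (simp add: orthonormal_def cinner_self)
  have B0: "cinner b c = 0" if "b \<in> B" "c \<in> B" "b \<noteq> c" for b c
    using B that by (auto simp: orthonormal_def pairwise_def)
  have "countable B"
  proof (rule separated_countable [OF sep zero_less_one])
    show "1 \<le> dist b c" if "b \<in> B" "c \<in> B" "b \<noteq> c" for b c
      using dist_orthogonal [OF B0 [OF that]] B that by (simp add: orthonormal_def)
  qed
  moreover have "infinite B"
  proof
    assume fin: "finite B"
    have "x \<in> complex_vector.span B" for x
    proof -
      define y where "y = (\<Sum>b\<in>B. cinner x b *\<^sub>C b)"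
      have "x - y = 0"
      proof (rule complete)
        fix b assume b: "b \<in> B"
        have "cinner y b = (\<Sum>c\<in>B. if c = b then cinner x b else 0)"
          unfolding y_def cinner_sum_left
          by (rule sum.cong) (auto simp: cinner_simps B1 B0 b)
        then show "cinner (x - y) b = 0" using fin b by (simp add: cinner_simps)
      qed
      moreover have "y \<in> complex_vector.span B"
        unfolding y_def
        by (intro complex_vector.span_sum complex_vector.span_scale complex_vector.span_base)
      ultimately show ?thesis by simp
    qed
    then show False using inf fin by (auto simp: infinite_cdim_def)
  qed
  ultimately have bij: "bij_betw (from_nat_into B) UNIV B" by (rule bij_betw_from_nat_into)
  have "onb (from_nat_into B)"
    unfolding onb_def
  proof (intro conjI allI impI)
    show "cinner (from_nat_into B m) (from_nat_into B n) = (if m = n then 1 else 0)" for m n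
    proof -
      have "inj (from_nat_into B)" "from_nat_into B k \<in> B" for k
        using bij by (auto simp: bij_betw_def)
      then show ?thesis by (auto simp: B1 B0 inj_eq)
    qed
    show "x = 0" if "\<forall>n. cinner x (from_nat_into B n) = 0" for x
      using that bij complete by (metis bij_betw_def imageE)
  qed
  then show thesis by (rule that)
qed

context
  fixes e :: "nat \<Rightarrow> 'a::chilbert_space"
  assumes e: "onb e"
begin

lemma onb_cinner: "cinner (e m) (e n) = (if m = n then 1 else 0)"
  using e by (simp add: onb_def)

lemma onb_norm: "norm (e n) = 1"
  by (rule norm_eq_1I) (simp add: onb_cinner)

lemma onb_eq_zeroI: "(\<And>n. cinner x (e n) = 0) \<Longrightarrow> x = 0"
  using e by (simp add: onb_def)

lemma onb_bessel:
  assumes "finite F"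
  shows "(\<Sum>n\<in>F. (cmod (cinner x (e n)))\<^sup>2) \<le> (norm x)\<^sup>2"
proof -
  have "cinner (cinner x (e n) *\<^sub>C e n) x = complex_of_real ((norm (cinner x (e n) *\<^sub>C e n))\<^sup>2)" for n
    unfolding norm_scaleC onb_norm mult_1_right complex_norm_square
    using cinner_commute [of "e n" x] by (simp add: cinner_simps)
  then have "(\<Sum>n\<in>F. (norm (cinner x (e n) *\<^sub>C e n))\<^sup>2) \<le> (norm x)\<^sup>2"
    by (intro bessel) (simp_all add: pairwise_def cinner_simps onb_cinner)
  then show ?thesis by (simp add: norm_scaleC onb_norm)
qed

text \<open>\<open>W\<close> replaces \<open>e n\<close> by \<open>f n\<close> in the Fourier series
  of \<open>x\<close>; both series have the same coefficients and hence the same norm.\<close>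

lemma isometry_of_onb:
  assumes f: "\<And>m n. cinner (f m) (f n) = (if m = n then 1 else 0 :: complex)"
  obtains W :: "'a bop" where "isometry W" "\<And>n. W (e n) = f n"
    "\<And>x. ((\<lambda>n. cinner x (e n) *\<^sub>C f n) has_sum W x) UNIV"
proof -
  \<comment> \<open>Stated for any orthonormal sequence \<open>g\<close>, as it is needed for both
    \<open>e\<close> and \<open>f\<close>.\<close>
  have expand: "(\<lambda>n. cinner x (e n) *\<^sub>C g n) summable_on UNIV"
      "pairwise (\<lambda>m n. cinner (cinner x (e m) *\<^sub>C g m) (cinner x (e n) *\<^sub>C g n) = 0) UNIV"
      "\<And>n. norm (g n) = 1"
    if g: "\<And>m n. cinner (g m) (g n) = (if m = n then 1 else 0 :: complex)" for g :: "nat \<Rightarrow> 'a" and x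
  proof -
    show orth: "pairwise (\<lambda>m n. cinner (cinner x (e m) *\<^sub>C g m) (cinner x (e n) *\<^sub>C g n) = 0) UNIV"
      by (auto simp: pairwise_def cinner_simps g)
    show 1: "norm (g n) = 1" for n
      by (rule norm_eq_1I) (simp add: g)
    show "(\<lambda>n. cinner x (e n) *\<^sub>C g n) summable_on UNIV"
      by (rule orthogonal_summable_on [OF orth]) (use 1 onb_bessel in \<open>simp add: norm_scaleC\<close>)
  qed
  define w where "w x = (\<Sum>\<^sub>\<infinity>n. cinner x (e n) *\<^sub>C f n)" for x
  have w: "((\<lambda>n. cinner x (e n) *\<^sub>C f n) has_sum w x) UNIV" for x
    unfolding w_def by (rule has_sum_infsum [OF expand(1) [OF f]])
  have norm_w: "norm (w x) = norm x" for x
  proof -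
    define y where "y = (\<Sum>\<^sub>\<infinity>n. cinner x (e n) *\<^sub>C e n)"
    have y: "((\<lambda>n. cinner x (e n) *\<^sub>C e n) has_sum y) UNIV"
      unfolding y_def by (rule has_sum_infsum [OF expand(1) [OF onb_cinner]])
    have "cinner (x - y) (e n) = 0" for n
    proof -
      have "((\<lambda>m. cinner (cinner x (e m) *\<^sub>C e m) (e n)) has_sum cinner x (e n)) UNIV"
        by (rule has_sum_finite_neutralI [of "{n}"]) (auto simp: cinner_simps onb_cinner)
      then have "cinner y (e n) = cinner x (e n)"
        using has_sum_cinner_left [OF y] has_sum_unique by blast
      then show ?thesis by (simp add: cinner_simps)
    qed
    then have "x = y" using onb_eq_zeroI [of "x - y"] by simp
    then have "((\<lambda>n. (norm (cinner x (e n) *\<^sub>C e n))\<^sup>2) has_sum (norm x)\<^sup>2) UNIV"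
      using has_sum_norm_sq [OF expand(2) [OF onb_cinner] y] by simp
    then have x: "((\<lambda>n. (cmod (cinner x (e n)))\<^sup>2) has_sum (norm x)\<^sup>2) UNIV"
      by (simp add: norm_scaleC onb_norm)
    have "((\<lambda>n. (norm (cinner x (e n) *\<^sub>C f n))\<^sup>2) has_sum (norm (w x))\<^sup>2) UNIV"
      by (rule has_sum_norm_sq [OF expand(2) [OF f] w])
    then have "((\<lambda>n. (cmod (cinner x (e n)))\<^sup>2) has_sum (norm (w x))\<^sup>2) UNIV"
      by (simp add: norm_scaleC expand(3) [OF f])
    from has_sum_unique [OF this x] have "(norm (w x))\<^sup>2 = (norm x)\<^sup>2" .
    then show ?thesis by (rule power2_eq_imp_eq) simp_all
  qed
  have add: "w (x + y) = w x + w y" for x y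
  proof (rule has_sum_unique [OF w])
    show "((\<lambda>n. cinner (x + y) (e n) *\<^sub>C f n) has_sum (w x + w y)) UNIV"
      using has_sum_add [OF w [of x] w [of y]] by (simp add: cinner_simps scaleC_add_left)
  qed
  have scale: "w (c *\<^sub>C x) = c *\<^sub>C w x" for c x
  proof (rule has_sum_unique [OF w])
    show "((\<lambda>n. cinner (c *\<^sub>C x) (e n) *\<^sub>C f n) has_sum c *\<^sub>C w x) UNIV"
      using has_sum_bounded_linear [OF bounded_linear_scaleC_right w [of x], of c]
      by (simp add: cinner_simps scaleC_scaleC)
  qed
  have "bop_apply (Bop w) = w"
    by (rule bop_apply_Bop [of _ 1]) (simp_all add: semilinear_def add scale norm_w)
  moreover have "w (e n) = f n" for n
  proof (rule has_sum_unique [OF w])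
    show "((\<lambda>m. cinner (e n) (e m) *\<^sub>C f m) has_sum f n) UNIV"
      by (rule has_sum_finite_neutralI [of "{n}"]) (auto simp: onb_cinner scaleC_one)
  qed
  ultimately show thesis
    using that [of "Bop w"] w norm_w by (simp add: isometry_def)
qed

lemma isometry_of_inj:
  assumes "inj g"
  obtains W :: "'a bop" where "isometry W" "\<And>n. W (e n) = e (g n)"
    "\<And>x. ((\<lambda>n. cinner x (e n) *\<^sub>C e (g n)) has_sum W x) UNIV"
  using isometry_of_onb [of "\<lambda>n. e (g n)"] assms by (auto simp: onb_cinner inj_eq)

end

section \<open>Pairs of isometries with complementary ranges\<close>

definition cuntz_pair :: "'a::chilbert_space bop \<Rightarrow> 'a bop \<Rightarrow> bool" where
  "cuntz_pair S T \<longleftrightarrow> isometry S \<and> isometry T \<and> adj S o\<^sub>B T = 0 \<and>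
    (S o\<^sub>B adj S) + (T o\<^sub>B adj T) = bop_id"

text \<open>\<open>S\<close> and \<open>T\<close> map the basis onto its members of even and of odd
  index.\<close>

lemma cuntz_pair_exists:
  fixes e :: "nat \<Rightarrow> 'a::chilbert_space"
  assumes e: "onb e"
  obtains S T :: "'a bop" where "cuntz_pair S T"
proof -
  have inj: "inj (\<lambda>n :: nat. 2 * n)" "inj (\<lambda>n :: nat. 2 * n + 1)" by (auto intro: injI)
  obtain S :: "'a bop"
    where S: "isometry S" "\<And>n. S (e n) = e (2 * n)"
      and "\<And>x. ((\<lambda>n. cinner x (e n) *\<^sub>C e (2 * n)) has_sum S x) UNIV"
    by (rule isometry_of_inj [OF e inj(1)]) (rule that)
  obtain T :: "'a bop"
    where T: "isometry T" "\<And>n. T (e n) = e (2 * n + 1)"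
      and Tsum: "\<And>x. ((\<lambda>n. cinner x (e n) *\<^sub>C e (2 * n + 1)) has_sum T x) UNIV"
    by (rule isometry_of_inj [OF e inj(2)]) (rule that)
  have zero: "adj S (T x) = 0" for x
  proof (rule onb_eq_zeroI [OF e])
    fix n
    have "((\<lambda>m. cinner (cinner x (e m) *\<^sub>C e (2 * m + 1)) (e (2 * n))) has_sum cinner (T x) (e (2 * n))) UNIV"
      by (rule has_sum_cinner_left [OF Tsum])
    moreover have "cinner (e (2 * m + 1)) (e (2 * n)) = 0" for m
      using onb_cinner [OF e, of "2 * m + 1" "2 * n"] by presburger
    ultimately have "((\<lambda>m :: nat. 0) has_sum cinner (T x) (e (2 * n))) UNIV"
      by (simp add: cinner_simps)
    then have "cinner (T x) (S (e n)) = 0"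
      unfolding S(2) by (rule has_sum_unique) simp
    then show "cinner (adj S (T x)) (e n) = 0" by (simp add: cinner_adj(2))
  qed
  have zero': "adj T (S x) = 0" for x
  proof (rule cinner_ext)
    fix y
    have "cinner (T y) (S x) = cinner (adj S (T y)) x" by (simp add: cinner_adj(2))
    then show "cinner y (adj T (S x)) = cinner y 0" by (simp add: zero cinner_adj(1))
  qed
  have "S (adj S x) + T (adj T x) = x" for x
  proof -
    define z where "z = x - (S (adj S x) + T (adj T x))"
    have "adj S z = 0" "adj T z = 0"
      using S(1) T(1) by (simp_all add: z_def bop_linear zero zero')
    then have "cinner z (S (e n)) = 0" "cinner z (T (e n)) = 0" for n
      by (simp_all add: cinner_adj(2) [symmetric])
    then have "cinner z (e n) = 0" for n
      by (cases "even n") (auto simp: S(2) T(2) elim!: evenE oddE)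
    then have "z = 0" by (rule onb_eq_zeroI [OF e])
    then show ?thesis by (simp add: z_def)
  qed
  then have "cuntz_pair S T"
    unfolding cuntz_pair_def using S(1) T(1) zero by (auto intro!: bop_eqI)
  then show thesis by (rule that)
qed

section \<open>Preservers and isometries\<close>

text \<open>A coisometry \<open>B\<close> this close to \<open>A\<close> is injective, since
  \<open>B y = 0\<close> gives \<open>norm y = norm ((A - B) y)\<close>; then
  \<open>B (adj B (B x)) = B x\<close> can be cancelled.\<close>

lemma near_isometry:
  fixes A B :: "'a::chilbert_space bop"
  assumes A: "isometry A" and B: "extreme B" and near: "norm (A - B) < 1"
  shows "isometry B"
proof (cases "isometry B")
  case False
  then have coiso: "B o\<^sub>B adj B = bop_id" using B by (auto simp: extreme_def isometry_iff)
  have inj: "y = 0" if "B y = 0" for y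
  proof (rule ccontr)
    assume "y \<noteq> 0"
    have "norm y = norm (bop_apply (A - B) y)" using that A by (simp add: isometry_def)
    also have "\<dots> \<le> norm (A - B) * norm y" by (rule norm_bop_apply)
    also have "\<dots> < norm y" using near \<open>y \<noteq> 0\<close> by simp
    finally show False by simp
  qed
  have "adj B (B x) = x" for x
  proof -
    have "B (adj B (B x)) = B x" using arg_cong [OF coiso, of "\<lambda>X. bop_apply X (B x)"] by simp
    then have "B (adj B (B x) - x) = 0" by (simp add: bop_linear)
    from inj [OF this] show ?thesis by simp
  qed
  then show ?thesis unfolding isometry_iff by (intro bop_eqI) simp
qed

lemma cos_sin_lipschitz: "\<bar>cos s - cos t\<bar> \<le> \<bar>s - t\<bar>" "\<bar>sin s - sin t\<bar> \<le> \<bar>s - t\<bar>" for s t :: real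
proof -
  have *: "\<bar>2 * (a * sin h)\<bar> \<le> \<bar>2 * h\<bar>" if "\<bar>a\<bar> \<le> 1" for a h :: real
    using mult_mono [OF that abs_sin_x_le_abs_x [of h]] by (simp add: abs_mult)
  have "cos s - cos t = 2 * (sin ((s + t) / 2) * sin ((t - s) / 2))"
    by (simp add: cos_diff_cos)
  then show "\<bar>cos s - cos t\<bar> \<le> \<bar>s - t\<bar>"
    using * [of "sin ((s + t) / 2)" "(t - s) / 2"] by simp
  have "sin s - sin t = 2 * (cos ((s + t) / 2) * sin ((s - t) / 2))"
    by (simp add: sin_diff_sin)
  then show "\<bar>sin s - sin t\<bar> \<le> \<bar>s - t\<bar>"
    using * [of "cos ((s + t) / 2)" "(s - t) / 2"] by simp
qed

text \<open>Along the path \<open>cos t E + sin t F\<close> every point is extreme, and by the previous lemma it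
  cannot leave the isometries.\<close>

lemma isometry_rotation:
  fixes E F :: "'a::chilbert_space bop"
  assumes E: "isometry E" and F: "norm F \<le> 1"
    and ext: "\<And>t. extreme (cos t *\<^sub>R E + sin t *\<^sub>R F)"
  shows "isometry (cos t *\<^sub>R E + sin t *\<^sub>R F)"
proof -
  define G where "G t = cos t *\<^sub>R E + sin t *\<^sub>R F" for t
  \<comment> \<open>Steps shorter than \<open>1/2\<close> move \<open>G\<close> by less than 1, the
    threshold of \<open>near_isometry\<close>; \<open>N\<close> below divides \<open>t\<close> into
    such steps.\<close>
  have step: "isometry (G s)" if "isometry (G r)" "\<bar>r - s\<bar> < 1/2" for r s
  proof (rule near_isometry [OF that(1)])
    show "extreme (G s)" unfolding G_def by (rule ext)
    have "G r - G s = (cos r - cos s) *\<^sub>R E + (sin r - sin s) *\<^sub>R F"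
      by (simp add: G_def scaleR_diff_left)
    then have "norm (G r - G s) \<le> \<bar>cos r - cos s\<bar> * norm E + \<bar>sin r - sin s\<bar> * norm F"
      by (metis norm_triangle_ineq norm_scaleR)
    also have "\<dots> \<le> \<bar>r - s\<bar> * 1 + \<bar>r - s\<bar> * 1"
      by (intro add_mono mult_mono cos_sin_lipschitz isometry_norm_le E F) auto
    also have "\<dots> < 1" using that(2) by simp
    finally show "norm (G r - G s) < 1" .
  qed
  have base: "isometry (G 0)" using E by (simp add: G_def)
  obtain N :: nat where N: "2 * \<bar>t\<bar> < real N" using reals_Archimedean2 by blast
  then have N0: "real N > 0" by (meson abs_ge_zero le_less_trans mult_nonneg_nonneg zero_le_numeral)
  have "isometry (G (real n * (t / real N)))" for n
  proof (induction n)
    case (Suc n)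
    have "\<bar>t / real N\<bar> < 1/2" using N N0 by (simp add: abs_divide divide_less_eq)
    moreover have "real n * (t / real N) - real (Suc n) * (t / real N) = - (t / real N)"
      by (simp add: distrib_right add_divide_distrib)
    ultimately show ?case by (intro step [OF Suc]) (simp only: abs_minus_cancel)
  qed (simp add: base)
  from this [of N] show ?thesis using N0 by (simp add: G_def)
qed

text \<open>The rotation reaches \<open>F\<close> at angle \<open>pi / 2\<close>. At
  \<open>pi / 4\<close>, with \<open>F\<close> multiplied by a phase \<open>z\<close>, norm
  preservation gives \<open>Re (cinner (E x) (z *\<^sub>C F x)) = 0\<close>; the phases 1 and
  \<open>\<i>\<close> give \<open>cinner (E x) (F x) = 0\<close>, and polarization separates
  \<open>x\<close> from \<open>y\<close>.\<close>

lemma isometry_pair_orthogonal: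
  fixes E F :: "'a::chilbert_space bop"
  assumes E: "isometry E"
    and ext: "\<And>a b. (cmod a)\<^sup>2 + (cmod b)\<^sup>2 = 1 \<Longrightarrow> extreme (a *\<^sub>C E + b *\<^sub>C F)"
  shows "isometry F" "cinner (E x) (F y) = 0"
proof -
  have rot: "isometry (cos t *\<^sub>R E + sin t *\<^sub>R (z *\<^sub>C F))" if z: "cmod z = 1" for t z
  proof (rule isometry_rotation [OF E])
    show "norm (z *\<^sub>C F) \<le> 1"
      using extreme_norm_le [OF ext [of 0 z]] z by (simp add: complex_vector.scale_zero_left)
    show "extreme (cos t *\<^sub>R E + sin t *\<^sub>R (z *\<^sub>C F))" for t
      using ext [of "complex_of_real (cos t)" "complex_of_real (sin t) * z"] z
      by (simp add: scaleR_scaleC scaleC_scaleC norm_mult)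
  qed
  from rot [of 1 "pi / 2"] show F: "isometry F" by (simp add: scaleC_one)
  have "isometry ((sqrt 2 / 2) *\<^sub>R (E + z *\<^sub>C F))" if "cmod z = 1" for z
    using rot [OF that, of "pi / 4"] by (simp add: cos_45 sin_45 scaleR_add_right)
  then have half: "sqrt 2 / 2 * norm (E x + z *\<^sub>C F x) = norm x" if "cmod z = 1" for z x
    using that unfolding isometry_def by simp
  have sq: "(norm (E x + z *\<^sub>C F x))\<^sup>2 = 2 * (norm x)\<^sup>2" if "cmod z = 1" for z x
    unfolding half [OF that, of x, symmetric] by (simp add: power_mult_distrib power_divide)
  have Re0: "Re (cinner (E x) (z *\<^sub>C F x)) = 0" if "cmod z = 1" for z x
    using sq [OF that, of x] that E F by (simp add: norm_add_sq isometry_def norm_scaleC)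
  have diag: "cinner (E x) (F x) = 0" for x
    using Re0 [of 1 x] Re0 [of \<i> x] by (simp add: complex_eq_iff cinner_scaleC_right scaleC_one)
  have "cinner (E x) (F y) + cinner (E y) (F x) = 0"
    using diag [of "x + y"] diag [of x] diag [of y] by (simp add: bop_linear cinner_simps add.commute)
  moreover have "\<i> * cinner (E x) (F y) - \<i> * cinner (E y) (F x) = 0"
    using diag [of "\<i> *\<^sub>C x + y"] diag [of x] diag [of y]
    by (simp add: bop_linear cinner_simps algebra_simps)
  ultimately show "cinner (E x) (F y) = 0"
    by (simp add: right_diff_distrib [symmetric] del: right_diff_distrib)
qed

definition preserves_extreme :: "('a::chilbert_space bop \<Rightarrow> 'a bop) \<Rightarrow> bool" where
  "preserves_extreme \<Phi> \<longleftrightarrow> (\<forall>A. extreme A \<longrightarrow> extreme (\<Phi> A))"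

lemma cuntz_pairD:
  assumes "cuntz_pair S T"
  shows "isometry S" "isometry T" "cinner (S x) (T y) = 0" "cinner (T y) (S x) = 0"
    "(S o\<^sub>B adj S) + (T o\<^sub>B adj T) = bop_id"
proof -
  show "isometry S" "isometry T" "(S o\<^sub>B adj S) + (T o\<^sub>B adj T) = bop_id"
    using assms by (simp_all add: cuntz_pair_def)
  have "bop_apply (adj S o\<^sub>B T) y = 0" using assms unfolding cuntz_pair_def by simp
  then show "cinner (S x) (T y) = 0" by (simp add: cinner_adj(1))
  then show "cinner (T y) (S x) = 0" by (subst cinner_commute) simp
qed

section \<open>Multiplicativity of extreme point preservers\<close>

context conj_or_id
begin

context
  fixes \<Phi> :: "'a::chilbert_space bop \<Rightarrow> 'a bop"
  assumes lin: "semilinear \<sigma> \<Phi>" and pres: "preserves_extreme \<Phi>"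
begin

lemma preserver_orthogonal:
  assumes E: "isometry E" and F: "isometry F" and orth: "\<And>x y. cinner (E x) (F y) = 0"
    and image: "isometry (\<Phi> E)"
  shows "isometry (\<Phi> F)" "cinner (\<Phi> E x) (\<Phi> F y) = 0"
proof -
  have *: "extreme (a *\<^sub>C \<Phi> E + b *\<^sub>C \<Phi> F)" if ab: "(cmod a)\<^sup>2 + (cmod b)\<^sup>2 = 1" for a b
  proof -
    \<comment> \<open>\<open>\<sigma>\<close> is an involution, so the coefficients
      \<open>\<sigma> a\<close> and \<open>\<sigma> b\<close> become \<open>a\<close> and
      \<open>b\<close> under \<open>\<Phi>\<close>.\<close>
    have "isometry (\<sigma> a *\<^sub>C E + \<sigma> b *\<^sub>C F)"
      unfolding isometry_def
    proof
      fix x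
      have "(norm (bop_apply (\<sigma> a *\<^sub>C E + \<sigma> b *\<^sub>C F) x))\<^sup>2 = ((cmod a)\<^sup>2 + (cmod b)\<^sup>2) * (norm x)\<^sup>2"
        using E F by (simp add: norm_add_sq cinner_simps orth norm_scaleC isometry_def sigma_simps
            power_mult_distrib distrib_right)
      then show "norm (bop_apply (\<sigma> a *\<^sub>C E + \<sigma> b *\<^sub>C F) x) = norm x" using ab by simp
    qed
    then have "extreme (\<Phi> (\<sigma> a *\<^sub>C E + \<sigma> b *\<^sub>C F))"
      using pres by (simp add: preserves_extreme_def extreme_def)
    then show ?thesis by (simp add: semilinearD [OF lin] sigma_simps)
  qed
  show "isometry (\<Phi> F)" by (rule isometry_pair_orthogonal [OF image *])
  show "cinner (\<Phi> E x) (\<Phi> F y) = 0" by (rule isometry_pair_orthogonal [OF image *])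
qed

context
  fixes S T :: "'a bop"
  assumes pair: "cuntz_pair S T" and image: "isometry (\<Phi> S)"
begin

lemmas pairD = cuntz_pairD [OF pair]

text \<open>Ranges must be orthogonal to transfer the property, so it goes from \<open>S\<close> to
  \<open>T U\<close> and then from \<open>T\<close> back to \<open>S U\<close>.\<close>

lemma preserver_isometry:
  assumes "isometry U"
  shows "isometry (\<Phi> (S o\<^sub>B U))" "isometry (\<Phi> (T o\<^sub>B U))"
proof -
  have T: "isometry (\<Phi> (T o\<^sub>B W))" if "isometry W" for W
    by (rule preserver_orthogonal(1) [OF pairD(1) _ _ image])
      (simp_all add: isometry_compose pairD that)
  then show "isometry (\<Phi> (T o\<^sub>B U))" using assms .
  from T [OF isometry_id] have "isometry (\<Phi> T)" by simp
  then show "isometry (\<Phi> (S o\<^sub>B U))"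
    by (rule preserver_orthogonal(1) [OF pairD(2), rotated 2])
      (simp_all add: isometry_compose pairD assms)
qed

lemma preserver_cross:
  "cinner (\<Phi> (S o\<^sub>B A) x) (\<Phi> (T o\<^sub>B B) y) = 0"
proof (induction A rule: bop_unitary_induct)
  case (unitary U)
  then have U: "isometry U" by (simp add: unitary_iff)
  show ?case
  proof (induction B rule: bop_unitary_induct)
    case (unitary W)
    then have W: "isometry W" by (simp add: unitary_iff)
    show ?case
      by (rule preserver_orthogonal(2))
        (simp_all add: isometry_compose pairD U W preserver_isometry)
  qed (simp_all add: bop_compose_linear semilinearD [OF lin] cinner_simps)
qed (simp_all add: bop_compose_linear semilinearD [OF lin] cinner_simps)

text \<open>The isometries \<open>(S U + T) / sqrt 2\<close> and \<open>(S U - T) / sqrt 2\<close>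
  have orthogonal ranges. Their images, multiplied by \<open>X\<close> and \<open>Y\<close>, are
  then orthogonal too; the mixed terms vanish by \<open>preserver_cross\<close>, and what remains is
  the difference of the two sides.\<close>

lemma preserver_rotated:
  assumes U: "isometry U" and X: "isometry X" and Y: "isometry Y"
  shows "cinner (\<Phi> (S o\<^sub>B U o\<^sub>B X) x) (\<Phi> (S o\<^sub>B U o\<^sub>B Y) y) = cinner (\<Phi> (T o\<^sub>B X) x) (\<Phi> (T o\<^sub>B Y) y)"
proof -
  define r where "r = sqrt 2 / 2"
  have r: "r\<^sup>2 = 1/2" by (simp add: r_def power_divide)
  define G where "G s = r *\<^sub>R ((S o\<^sub>B U) + s *\<^sub>R T)" for s
  \<comment> \<open>Needed before \<open>\<Phi>\<close> for \<open>S U\<close> and \<open>T\<close>,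
    and after \<open>\<Phi>\<close> for their images.\<close>
  have iso: "isometry (r *\<^sub>R (E + s *\<^sub>R F))"
    if "isometry E" "isometry F" "\<And>x y. cinner (E x) (F y) = 0" "s = 1 \<or> s = -1"
    for E F :: "'a bop" and s
    unfolding isometry_def
  proof
    fix x
    have "(norm (E x + s *\<^sub>R F x))\<^sup>2 = 2 * (norm x)\<^sup>2"
      using that by (auto simp: norm_add_sq isometry_def cinner_minus_right)
    then have "(norm (bop_apply (r *\<^sub>R (E + s *\<^sub>R F)) x))\<^sup>2 = (norm x)\<^sup>2"
      by (simp add: power_mult_distrib r)
    then show "norm (bop_apply (r *\<^sub>R (E + s *\<^sub>R F)) x) = norm x"
      by (rule power2_eq_imp_eq) simp_all
  qed
  have G: "isometry (G s)" if "s = 1 \<or> s = -1" for s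
    unfolding G_def by (rule iso) (simp_all add: that isometry_compose pairD U)
  have image: "isometry (\<Phi> (G 1 o\<^sub>B X))"
  proof -
    have "\<Phi> (G 1 o\<^sub>B X) = r *\<^sub>R (\<Phi> (S o\<^sub>B (U o\<^sub>B X)) + 1 *\<^sub>R \<Phi> (T o\<^sub>B X))"
      by (simp add: G_def bop_compose_linear semilinearD [OF lin] bop_compose_assoc)
    moreover have "isometry (r *\<^sub>R (\<Phi> (S o\<^sub>B (U o\<^sub>B X)) + 1 *\<^sub>R \<Phi> (T o\<^sub>B X)))"
      by (rule iso) (simp_all add: preserver_isometry preserver_cross isometry_compose U X)
    ultimately show ?thesis by simp
  qed
  have "cinner (\<Phi> (G 1 o\<^sub>B X) x) (\<Phi> (G (-1) o\<^sub>B Y) y) = 0"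
  proof (rule preserver_orthogonal(2) [OF _ _ _ image])
    show "isometry (G 1 o\<^sub>B X)" "isometry (G (-1) o\<^sub>B Y)"
      by (simp_all add: isometry_compose G X Y)
    show "cinner (bop_apply (G 1 o\<^sub>B X) x) (bop_apply (G (-1) o\<^sub>B Y) y) = 0" for x y
      by (simp add: G_def cinner_simps pairD isometry_cinner U)
  qed
  moreover have "cinner (\<Phi> (T o\<^sub>B B) y) (\<Phi> (S o\<^sub>B A) x) = 0" for A B x y
    by (subst cinner_commute) (simp add: preserver_cross)
  ultimately have "complex_of_real r * (complex_of_real r * (cinner (\<Phi> (S o\<^sub>B U o\<^sub>B X) x) (\<Phi> (S o\<^sub>B U o\<^sub>B Y) y)
      - cinner (\<Phi> (T o\<^sub>B X) x) (\<Phi> (T o\<^sub>B Y) y))) = 0"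
    by (simp add: G_def bop_compose_linear semilinearD [OF lin] cinner_simps preserver_cross
        bop_compose_assoc)
  then show ?thesis by (simp add: r_def)
qed

lemma preserver_S_T:
  "cinner (\<Phi> (S o\<^sub>B A) x) (\<Phi> (S o\<^sub>B B) y) = cinner (\<Phi> (T o\<^sub>B A) x) (\<Phi> (T o\<^sub>B B) y)"
proof (induction A rule: bop_unitary_induct)
  case (unitary U)
  then have U: "isometry U" by (simp add: unitary_iff)
  show ?case
  proof (induction B rule: bop_unitary_induct)
    case (unitary W)
    then have "isometry W" by (simp add: unitary_iff)
    from preserver_rotated [OF isometry_id U this] show ?case by simp
  qed (simp_all add: bop_compose_linear semilinearD [OF lin] cinner_simps)
qed (simp_all add: bop_compose_linear semilinearD [OF lin] cinner_simps)

text \<open>For unitary \<open>U\<close> a common left factor cancels, by passing through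
  \<open>T\<close> and back. Writing \<open>B\<close> as \<open>U (adj U B)\<close> moves
  \<open>U\<close> to the other side, and both sides depend on \<open>A\<close> in the same
  semilinear way.\<close>

lemma preserver_S:
  "cinner (\<Phi> (S o\<^sub>B A) x) (\<Phi> (S o\<^sub>B B) y) = cinner (\<Phi> S x) (\<Phi> (S o\<^sub>B (adj A o\<^sub>B B)) y)"
proof (induction A rule: bop_unitary_induct)
  case (unitary U)
  then have U: "isometry U" "U o\<^sub>B adj U = bop_id"
    by (simp add: unitary_iff, simp add: unitary_def)
  have *: "cinner (\<Phi> (S o\<^sub>B U) x) (\<Phi> (S o\<^sub>B (U o\<^sub>B B)) y) = cinner (\<Phi> S x) (\<Phi> (S o\<^sub>B B) y)" for B
  proof (induction B rule: bop_unitary_induct)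
    case (unitary W)
    then have "isometry W" by (simp add: unitary_iff)
    from preserver_rotated [OF U(1) isometry_id this, of x y]
    show ?case using preserver_S_T [of bop_id x W y] by (simp add: bop_compose_assoc)
  qed (simp_all add: bop_compose_linear semilinearD [OF lin] cinner_simps)
  have "U o\<^sub>B (adj U o\<^sub>B B) = B" by (simp add: U(2) flip: bop_compose_assoc)
  with * [of "adj U o\<^sub>B B"] show ?case by simp
qed (simp_all add: bop_compose_linear semilinearD [OF lin] cinner_simps sigma_simps)

text \<open>\<open>A\<close> and \<open>B\<close> are split by \<open>S adj S + T adj T = 1\<close>.
  The mixed terms vanish, the \<open>T\<close> part is rewritten with \<open>S\<close>, and the two
  parts reassemble to an expression in \<open>adj A B\<close> alone, which can be compared with the
  pair \<open>bop_id\<close>, \<open>adj A B\<close>.\<close>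

lemma preserver_multiplicative:
  "cinner (\<Phi> A x) (\<Phi> B y) = cinner (\<Phi> bop_id x) (\<Phi> (adj A o\<^sub>B B) y)"
  and preserver_id_isometry: "isometry (\<Phi> bop_id)"
proof -
  have main: "cinner (\<Phi> A x) (\<Phi> B y) = cinner (\<Phi> S x) (\<Phi> (S o\<^sub>B (adj A o\<^sub>B B)) y)" for A B x y
  proof -
    have split: "Z = (S o\<^sub>B (adj S o\<^sub>B Z)) + (T o\<^sub>B (adj T o\<^sub>B Z))" for Z
      using arg_cong [OF pairD(5), of "\<lambda>X. X o\<^sub>B Z"] by (simp add: bop_compose_linear bop_compose_assoc)
    have cross: "cinner (\<Phi> (T o\<^sub>B B) y) (\<Phi> (S o\<^sub>B A) x) = 0" for A B x y
      by (subst cinner_commute) (simp add: preserver_cross)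
    have "cinner (\<Phi> A x) (\<Phi> B y) =
        cinner (\<Phi> (S o\<^sub>B (adj S o\<^sub>B A)) x) (\<Phi> (S o\<^sub>B (adj S o\<^sub>B B)) y) +
        cinner (\<Phi> (T o\<^sub>B (adj T o\<^sub>B A)) x) (\<Phi> (T o\<^sub>B (adj T o\<^sub>B B)) y)"
      by (subst (1) split [of A], subst (1) split [of B])
        (simp add: semilinearD [OF lin] cinner_simps preserver_cross cross)
    also have "\<dots> = cinner (\<Phi> S x) (\<Phi> (S o\<^sub>B (adj A o\<^sub>B (S o\<^sub>B (adj S o\<^sub>B B)))) y) +
        cinner (\<Phi> S x) (\<Phi> (S o\<^sub>B (adj A o\<^sub>B (T o\<^sub>B (adj T o\<^sub>B B)))) y)"
      unfolding preserver_S_T [symmetric] preserver_S by (simp add: bop_compose_assoc)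
    also have "\<dots> = cinner (\<Phi> S x) (\<Phi> (S o\<^sub>B (adj A o\<^sub>B B)) y)"
      by (subst (3) split [of B]) (simp add: bop_compose_linear semilinearD [OF lin] cinner_simps)
    finally show ?thesis .
  qed
  show "cinner (\<Phi> A x) (\<Phi> B y) = cinner (\<Phi> bop_id x) (\<Phi> (adj A o\<^sub>B B) y)"
    using main [of A x B y] main [of bop_id x "adj A o\<^sub>B B" y] by simp
  have "(norm (\<Phi> bop_id x))\<^sup>2 = (norm (\<Phi> S x))\<^sup>2" for x
    using main [of bop_id x bop_id x] by (simp flip: Re_cinner_self)
  then show "isometry (\<Phi> bop_id)" using image by (simp add: isometry_def)
qed

end

end

end

section \<open>From preservers to unital star homomorphisms\<close>

definition star_hom ::
    "(complex \<Rightarrow> complex) \<Rightarrow> ('a::chilbert_space bop \<Rightarrow> 'a bop) \<Rightarrow> bool" where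
  "star_hom \<sigma> \<Theta> \<longleftrightarrow> semilinear \<sigma> \<Theta> \<and> \<Theta> bop_id = bop_id \<and>
    (\<forall>A B. \<Theta> (A o\<^sub>B B) = \<Theta> A o\<^sub>B \<Theta> B) \<and> (\<forall>A. \<Theta> (adj A) = adj (\<Theta> A))"

lemma star_homD:
  assumes "star_hom \<sigma> \<Theta>"
  shows "semilinear \<sigma> \<Theta>" "\<Theta> bop_id = bop_id" "\<Theta> (A o\<^sub>B B) = \<Theta> A o\<^sub>B \<Theta> B"
    "\<Theta> (adj A) = adj (\<Theta> A)"
  using assms by (auto simp: star_hom_def)

lemma star_hom_isometry: "star_hom \<sigma> \<Theta> \<Longrightarrow> isometry A \<Longrightarrow> isometry (\<Theta> A)"
  unfolding isometry_iff by (metis star_homD(2,3,4))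

lemma bop_apply_sum: "bop_apply (sum f F) x = (\<Sum>i\<in>F. bop_apply (f i) x)"
  by (induction F rule: infinite_finite_induct) simp_all

context conj_or_id
begin

text \<open>Multiplicativity and \<open>S adj S + T adj T = 1\<close> make
  \<open>(norm x)\<^sup>2\<close> the sum of the squared norms of \<open>\<Phi> (adj S) x\<close>
  and \<open>\<Phi> (adj T) x\<close>. If the first already exhausts it,
  \<open>\<Phi> (adj T)\<close> is zero, which is not extreme on a nonzero space.\<close>

lemma preserver_not_both_isometries:
  fixes \<Phi> :: "'a::chilbert_space bop \<Rightarrow> 'a bop" and x0 :: 'a
  assumes lin: "semilinear \<sigma> \<Phi>" and pres: "preserves_extreme \<Phi>"
    and pair: "cuntz_pair S T" and image: "isometry (\<Phi> S)" and x0: "x0 \<noteq> 0"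
  shows "\<not> isometry (\<Phi> (adj S))"
proof
  assume S: "isometry (\<Phi> (adj S))"
  have one: "isometry (\<Phi> bop_id)" by (rule preserver_id_isometry [OF lin pres pair image])
  have "\<Phi> (adj T) x = 0" for x
  proof (rule cinner_eq_zeroI)
    have eq: "cinner (\<Phi> (adj W) x) (\<Phi> (adj W) x) = cinner (\<Phi> bop_id x) (\<Phi> (W o\<^sub>B adj W) x)" for W
      using preserver_multiplicative [OF lin pres pair image, of "adj W" x "adj W" x] by simp
    have "\<Phi> bop_id = \<Phi> (S o\<^sub>B adj S) + \<Phi> (T o\<^sub>B adj T)"
      unfolding cuntz_pairD(5) [OF pair, symmetric] by (rule semilinearD [OF lin])
    then have "\<Phi> bop_id x = \<Phi> (S o\<^sub>B adj S) x + \<Phi> (T o\<^sub>B adj T) x" by simp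
    then have "cinner (\<Phi> bop_id x) (\<Phi> bop_id x) =
        cinner (\<Phi> bop_id x) (\<Phi> (S o\<^sub>B adj S) x) + cinner (\<Phi> bop_id x) (\<Phi> (T o\<^sub>B adj T) x)"
      by (metis cinner_add_right)
    then have "cinner x x = cinner x x + cinner (\<Phi> (adj T) x) (\<Phi> (adj T) x)"
      by (simp only: eq [symmetric] isometry_cinner [OF one] isometry_cinner [OF S])
    then show "cinner (\<Phi> (adj T) x) (\<Phi> (adj T) x) = 0" by simp
  qed
  then have "\<Phi> (adj T) = 0" by (intro bop_eqI) simp
  moreover have "extreme (\<Phi> (adj T))"
    using pres cuntz_pairD(2) [OF pair] by (simp add: preserves_extreme_def extreme_def)
  ultimately show False using x0 by (auto simp: extreme_def isometry_def)
qed

lemma preserver_star_hom: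
  fixes \<Phi> :: "'a::chilbert_space bop \<Rightarrow> 'a bop" and x0 :: 'a
  assumes lin: "semilinear \<sigma> \<Phi>" and pres: "preserves_extreme \<Phi>"
    and pair: "cuntz_pair S T" and image: "isometry (\<Phi> S)" and x0: "x0 \<noteq> 0"
  obtains V \<Theta> where "unitary V" "star_hom \<sigma> \<Theta>" "\<And>A. \<Phi> A = V o\<^sub>B \<Theta> A"
proof -
  note mult = preserver_multiplicative [OF lin pres pair image]
  define V where "V = \<Phi> bop_id"
  have V: "isometry V"
    unfolding V_def by (rule preserver_id_isometry [OF lin pres pair image])
  \<comment> \<open>\<open>\<Psi>\<close> is again a preserver with \<open>\<Psi> S\<close> an
    isometry, and \<open>\<Psi> bop_id = adj V\<close>; so \<open>adj V\<close> is an isometry as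
    well.\<close>
  define \<Psi> where "\<Psi> A = adj (\<Phi> (adj A))" for A
  have "semilinear \<sigma> \<Psi>"
    using lin by (simp add: \<Psi>_def semilinear_def sigma_simps)
  moreover have "preserves_extreme \<Psi>"
    using pres by (simp add: \<Psi>_def preserves_extreme_def)
  moreover have "extreme (\<Phi> (adj S))"
    using pres cuntz_pairD(1) [OF pair] by (simp add: preserves_extreme_def extreme_def)
  then have "isometry (\<Psi> S)"
    using preserver_not_both_isometries [OF lin pres pair image x0] by (simp add: extreme_def \<Psi>_def)
  ultimately have "isometry (\<Psi> bop_id)"
    using preserver_id_isometry pair by blast
  then have V': "isometry (adj V)" by (simp add: \<Psi>_def V_def)
  then have VV: "V o\<^sub>B adj V = bop_id" by (simp add: isometry_iff)
  define \<Theta> where "\<Theta> A = adj V o\<^sub>B \<Phi> A" for A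
  have \<Phi>: "\<Phi> A = V o\<^sub>B \<Theta> A" for A
    by (simp add: \<Theta>_def VV flip: bop_compose_assoc)
  have \<Theta>1: "\<Theta> bop_id = bop_id" using V by (simp add: \<Theta>_def V_def isometry_iff)
  \<comment> \<open>Cancelling \<open>V\<close> leaves a single identity; \<open>B = bop_id\<close>
    gives compatibility with \<open>adj\<close>, and then \<open>adj A\<close> for \<open>A\<close>
    gives multiplicativity.\<close>
  have star: "adj (\<Theta> A) o\<^sub>B \<Theta> B = \<Theta> (adj A o\<^sub>B B)" for A B
  proof (rule bop_eqI, rule cinner_ext)
    fix y x
    have "cinner (\<Phi> A x) (\<Phi> B y) = cinner (V x) (\<Phi> (adj A o\<^sub>B B) y)"
      using mult [of A x B y] by (simp add: V_def)
    then show "cinner x (bop_apply (adj (\<Theta> A) o\<^sub>B \<Theta> B) y) = cinner x (\<Theta> (adj A o\<^sub>B B) y)"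
      by (simp add: \<Phi> isometry_cinner [OF V] cinner_adj(1) V)
  qed
  have adj: "\<Theta> (adj A) = adj (\<Theta> A)" for A using star [of A bop_id] by (simp add: \<Theta>1)
  have "star_hom \<sigma> \<Theta>"
    unfolding star_hom_def
  proof (intro conjI allI \<Theta>1 adj)
    show "semilinear \<sigma> \<Theta>"
      using lin by (simp add: \<Theta>_def semilinear_def bop_compose_linear)
    show "\<Theta> (A o\<^sub>B B) = \<Theta> A o\<^sub>B \<Theta> B" for A B
      using star [of "adj A" B] by (simp add: adj)
  qed
  moreover have "unitary V" using V V' by (simp add: unitary_iff)
  ultimately show thesis using that \<Phi> by metis
qed

section \<open>Representations on a separable space\<close>

text \<open>The isometries \<open>e n \<mapsto> e (h a n)\<close> for \<open>a \<subseteq> \<nat>\<close>, where \<open>h a n\<close> encodes the first \<open>n\<close> bits of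
  \<open>a\<close>, have almost disjoint ranges.  If all rank one operators kill \<open>z\<close>, their images map \<open>z\<close> to
  an uncountable orthogonal family.\<close>

lemma star_hom_no_singular_part:
  fixes \<Theta> :: "'a::chilbert_space bop \<Rightarrow> 'a bop" and e :: "nat \<Rightarrow> 'a"
  assumes hom: "star_hom \<sigma> \<Theta>" and sep: "separable_space (euclidean :: 'a topology)"
    and e: "onb e" and zero: "\<And>a b. \<Theta> (rank_one a b) z = 0"
  shows "z = 0"
proof (rule ccontr)
  assume z: "z \<noteq> 0"
  \<comment> \<open>The first component records the prefix length, so \<open>h b n = h a m\<close>
    forces \<open>n = m\<close> and equal prefixes.\<close>
  define h where "h a n = prod_encode (n, set_encode {i \<in> a. i < n})" for a :: "nat set" and n :: nat
  have inj: "inj (h a)" for a by (auto simp: h_def intro: injI)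
  have "\<exists>W. isometry W \<and> (\<forall>n. W (e n) = e (h a n)) \<and>
      (\<forall>x. ((\<lambda>n. cinner x (e n) *\<^sub>C e (h a n)) has_sum W x) UNIV)" for a
    by (rule isometry_of_inj [OF e inj [of a]]) (intro exI conjI allI)
  then obtain W where W: "\<And>a. isometry (W a)" "\<And>a n. W a (e n) = e (h a n)"
    and sum: "\<And>a x. ((\<lambda>n. cinner x (e n) *\<^sub>C e (h a n)) has_sum W a x) UNIV" by metis
  have orth: "cinner (\<Theta> (W b) z) (\<Theta> (W a) z) = 0" if ab: "a \<noteq> b" for a b
  proof -
    obtain k where k: "k \<in> a \<longleftrightarrow> k \<notin> b" using ab by blast
    have "h b n \<noteq> h a m" if "n > k" for n m
    proof
      assume "h b n = h a m"
      then have "{i \<in> b. i < n} = {i \<in> a. i < n}" by (auto simp: h_def set_encode_eq)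
      with k that show False by blast
    qed
    then have 0: "adj (W a) (e (h b n)) = 0" if "n > k" for n
      by (intro onb_eq_zeroI [OF e]) (simp add: cinner_adj(2) W(2) onb_cinner [OF e] that)
    \<comment> \<open>Beyond \<open>k\<close> the prefixes differ, so the series stops and the
      product is a finite sum of rank one operators, whose images kill \<open>z\<close>.\<close>
    have "adj (W a) o\<^sub>B W b = (\<Sum>n\<le>k. rank_one (adj (W a) (e (h b n))) (e n))"
    proof (rule bop_eqI)
      fix x
      have "((\<lambda>n. adj (W a) (cinner x (e n) *\<^sub>C e (h b n))) has_sum adj (W a) (W b x)) UNIV"
        by (rule has_sum_bounded_linear [OF bounded_linear_bop sum])
      moreover have "((\<lambda>n. adj (W a) (cinner x (e n) *\<^sub>C e (h b n))) has_sum
          (\<Sum>n\<le>k. adj (W a) (cinner x (e n) *\<^sub>C e (h b n)))) UNIV"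
        by (rule has_sum_finite_neutralI [of "{..k}"])
          (auto simp: bop_linear 0 complex_vector.scale_zero_right)
      ultimately have "adj (W a) (W b x) = (\<Sum>n\<le>k. adj (W a) (cinner x (e n) *\<^sub>C e (h b n)))"
        by (rule has_sum_unique)
      then show "bop_apply (adj (W a) o\<^sub>B W b) x =
          bop_apply (\<Sum>n\<le>k. rank_one (adj (W a) (e (h b n))) (e n)) x"
        by (simp add: bop_apply_sum bop_linear)
    qed
    then have "\<Theta> (adj (W a) o\<^sub>B W b) z = 0"
      by (simp add: semilinear_sum [OF star_homD(1) [OF hom]] bop_apply_sum zero)
    then show ?thesis by (simp add: star_homD [OF hom] cinner_adj(3))
  qed
  have norm: "norm (\<Theta> (W a) z) = norm z" for a
    by (intro isometryD star_hom_isometry [OF hom] W)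
  have far: "norm z \<le> dist (\<Theta> (W a) z) (\<Theta> (W b) z)" if "a \<noteq> b" for a b
    using dist_orthogonal [OF orth [of b a]] that norm by metis
  have "inj (\<lambda>a. bop_apply (\<Theta> (W a)) z)"
  proof (rule injI, rule ccontr)
    fix a b assume "bop_apply (\<Theta> (W a)) z = bop_apply (\<Theta> (W b)) z" "a \<noteq> b"
    with far [of a b] z show False by simp
  qed
  moreover have "countable (range (\<lambda>a. bop_apply (\<Theta> (W a)) z))"
  proof (rule separated_countable [OF sep])
    show "norm z > 0" using z by simp
    fix x y assume "x \<in> range (\<lambda>a. bop_apply (\<Theta> (W a)) z)" "y \<in> range (\<lambda>a. bop_apply (\<Theta> (W a)) z)"
      and "x \<noteq> y"
    then obtain a b where "x = \<Theta> (W a) z" "y = \<Theta> (W b) z" "a \<noteq> b" by auto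
    then show "norm z \<le> dist x y" using far by simp
  qed
  ultimately have "countable (UNIV :: nat set set)" using countable_image_inj_on by blast
  then have "range (from_nat_into (UNIV :: nat set set)) = Pow UNIV" by simp
  then show False using Cantors_theorem by blast
qed

text \<open>\<open>K\<close> is the range of the projection
  \<open>\<Theta> (rank_one e0 e0)\<close>. Each vector \<open>f\<close> of an orthonormal basis of
  \<open>K\<close> generates a copy of the space through
  \<open>x \<mapsto> \<Theta> (rank_one x e0) f\<close>, on which \<open>\<Theta> A\<close> acts as
  \<open>A\<close>.\<close>

lemma star_hom_decomposition:
  fixes \<Theta> :: "'a::chilbert_space bop \<Rightarrow> 'a bop" and e :: "nat \<Rightarrow> 'a"
  assumes hom: "star_hom \<sigma> \<Theta>" and sep: "separable_space (euclidean :: 'a topology)"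
    and e: "onb e"
  obtains \<W> :: "('a \<Rightarrow> 'a) set" where
    "\<And>W. W \<in> \<W> \<Longrightarrow> semilinear \<sigma> W" "\<And>W x. W \<in> \<W> \<Longrightarrow> norm (W x) = norm x"
    "pairwise orthogonal_ranges \<W>" "ranges_generate \<W>"
    "\<And>W A x. W \<in> \<W> \<Longrightarrow> \<Theta> A (W x) = W (A x)"
proof -
  note \<Theta> = star_homD [OF hom]
  define e0 where "e0 = e 0"
  have e0: "cinner e0 e0 = 1" by (simp add: e0_def onb_cinner [OF e])
  define K where "K = {x. \<Theta> (rank_one e0 e0) x = x}"
  obtain B where B: "B \<subseteq> K" "orthonormal B"
    and max: "\<And>x. x \<in> K \<Longrightarrow> (\<And>b. b \<in> B \<Longrightarrow> cinner x b = 0) \<Longrightarrow> x = 0"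
    by (rule maximal_orthonormal [of K]) (simp_all add: K_def bop_linear)
  define W where "W f x = bop_apply (\<Theta> (rank_one x e0)) f" for f x
  have W_cinner: "cinner (W f x) (W g y) = cnj (\<sigma> (cinner y x)) * cinner f g" if "g \<in> B" for f g x y
  proof -
    have "cinner (W f x) (W g y) = cinner f (\<Theta> (rank_one e0 x o\<^sub>B rank_one y e0) g)"
      by (simp add: W_def cinner_adj(1) \<Theta> flip: \<Theta>(4)) (simp add: rank_one_simps)
    also have "\<dots> = cinner f (\<sigma> (cinner y x) *\<^sub>C \<Theta> (rank_one e0 e0) g)"
      by (simp only: rank_one_simps(4) semilinearD [OF \<Theta>(1)] bop_apply_simps)
    also have "\<Theta> (rank_one e0 e0) g = g" using that B by (auto simp: K_def)
    finally show ?thesis by (simp add: cinner_simps)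
  qed
  have B1: "cinner f f = 1" if "f \<in> B" for f
    using B that by (simp add: orthonormal_def cinner_self)
  show thesis
  proof (rule that [of "W ` B"])
    fix V assume "V \<in> W ` B"
    then obtain f where f: "f \<in> B" and V: "V = W f" by blast
    show "semilinear \<sigma> V"
      by (simp add: V W_def semilinear_def rank_one_simps semilinearD [OF \<Theta>(1)])
    show "norm (V x) = norm x" for x
    proof -
      have "(norm (V x))\<^sup>2 = (norm x)\<^sup>2"
        unfolding Re_cinner_self [symmetric] V W_cinner [OF f] by (simp add: B1 f sigma_simps)
      then show ?thesis by (rule power2_eq_imp_eq) simp_all
    qed
    show "\<Theta> A (V x) = V (A x)" for A x
      by (simp add: V W_def flip: rank_one_simps(2)) (simp add: \<Theta>)
  next
    show "pairwise orthogonal_ranges (W ` B)"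
      using B(2) by (auto simp: pairwise_def orthogonal_ranges_def W_cinner orthonormal_def)
    show "ranges_generate (W ` B)"
      unfolding ranges_generate_def
    proof (rule ccontr)
      assume "closure (complex_vector.span (\<Union>f\<in>W ` B. range f)) \<noteq> UNIV"
      then obtain z where "z \<noteq> 0" and z: "\<And>y. y \<in> (\<Union>f\<in>W ` B. range f) \<Longrightarrow> cinner z y = 0"
        by (rule exists_orthogonal) (rule that)
      \<comment> \<open>This vector lies in \<open>K\<close> and is orthogonal to \<open>B\<close>.
        Since every rank one operator factors through \<open>e0\<close>, all their images then kill
        \<open>z\<close>.\<close>
      have 0: "\<Theta> (rank_one e0 a) z = 0" for a
      proof (rule max)
        have "\<Theta> (rank_one e0 e0) (\<Theta> (rank_one e0 a) z) = \<Theta> (rank_one e0 e0 o\<^sub>B rank_one e0 a) z"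
          by (simp add: \<Theta>)
        then show "\<Theta> (rank_one e0 a) z \<in> K"
          by (simp add: K_def rank_one_simps e0 scaleC_one)
        fix f assume f: "f \<in> B"
        have "cinner (\<Theta> (rank_one e0 a) z) f = cinner z (\<Theta> (adj (rank_one e0 a)) f)"
          by (simp add: cinner_adj(1) \<Theta>(4))
        also have "\<dots> = cinner z (W f a)" by (simp add: rank_one_simps W_def)
        also have "\<dots> = 0" using z f by blast
        finally show "cinner (\<Theta> (rank_one e0 a) z) f = 0" .
      qed
      have "\<Theta> (rank_one a b) z = 0" for a b
      proof -
        have "rank_one a b = rank_one a e0 o\<^sub>B rank_one e0 b"
          by (simp add: rank_one_simps e0 scaleC_one)
        then show ?thesis by (simp add: \<Theta>(3) 0 bop_linear)
      qed
      then have "z = 0" by (rule star_hom_no_singular_part [OF hom sep e])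
      with \<open>z \<noteq> 0\<close> show False by contradiction
    qed
  qed
qed

end

section \<open>Families of isometries\<close>

text \<open>Indexing lets one argument serve sets of operators, indexed by themselves through
  \<open>bop_apply\<close>, and sets of anti-isometries.\<close>

locale isometry_family = conj_or_id +
  fixes I :: "'i set" and W W' :: "'i \<Rightarrow> 'a::chilbert_space \<Rightarrow> 'a"
  assumes semi: "\<And>i. i \<in> I \<Longrightarrow> semilinear \<sigma> (W i)"
    and norm: "\<And>i x. i \<in> I \<Longrightarrow> norm (W i x) = norm x"
    and adj: "\<And>i. i \<in> I \<Longrightarrow> is_adj \<sigma> (W i) (W' i)"
    and orth: "\<And>i j x y. i \<in> I \<Longrightarrow> j \<in> I \<Longrightarrow> i \<noteq> j \<Longrightarrow> cinner (W i x) (W j y) = 0"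
    and generate: "closure (complex_vector.span (\<Union>i\<in>I. range (W i))) = UNIV"
begin

lemma cinner_W: "i \<in> I \<Longrightarrow> cinner (W i x) (W i y) = \<sigma> (cinner x y)"
  by (rule semilinear_isometry_cinner [OF semi norm])

lemma cinner_W_adj:
  assumes "i \<in> I"
  shows "cinner (W i x) y = \<sigma> (cinner x (W' i y))" "cinner y (W i x) = \<sigma> (cinner (W' i y) x)"
  using is_adjD [OF adj [OF assms]] by simp_all

text \<open>The terms are the projections of \<open>x\<close> onto the ranges, summable by Bessel.
  The remainder is orthogonal to all ranges, hence to itself, as they generate.\<close>

lemma has_sum_resolution: "((\<lambda>i. W i (W' i x)) has_sum x) I"
proof -
  have orth': "pairwise (\<lambda>i j. cinner (W i (W' i x)) (W j (W' j x)) = 0) I"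
    by (auto simp: pairwise_def orth)
  have "(\<lambda>i. W i (W' i x)) summable_on I"
  proof (rule orthogonal_summable_on [OF orth'])
    fix F assume F: "F \<subseteq> I"
    show "(\<Sum>i\<in>F. (norm (W i (W' i x)))\<^sup>2) \<le> (norm x)\<^sup>2"
    proof (rule bessel [OF pairwise_subset [OF orth' F]])
      fix i assume "i \<in> F"
      then have i: "i \<in> I" using F by blast
      show "cinner (W i (W' i x)) x = complex_of_real ((norm (W i (W' i x)))\<^sup>2)"
        using i by (simp add: cinner_W_adj cinner_self norm sigma_simps del: of_real_power)
    qed
  qed
  then obtain s where s: "((\<lambda>i. W i (W' i x)) has_sum s) I" by (auto simp: summable_on_def)
  have "cinner (x - s) (W j y) = 0" if j: "j \<in> I" for j y
  proof -
    have "((\<lambda>i. cinner (W i (W' i x)) (W j y)) has_sum cinner x (W j y)) I"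
      by (rule has_sum_finite_neutralI [of "{j}"])
        (use j in \<open>auto simp: orth cinner_W cinner_W_adj(2) [of j x y]\<close>)
    then have "cinner s (W j y) = cinner x (W j y)"
      by (rule has_sum_unique [OF has_sum_cinner_left [OF s]])
    then show ?thesis by (simp add: cinner_simps)
  qed
  then have "cinner (x - s) y = 0" if "y \<in> (\<Union>i\<in>I. range (W i))" for y
    using that by blast
  then have "cinner (x - s) (x - s) = 0"
    by (rule orthogonal_closure_span [of "\<Union>i\<in>I. range (W i)"]) (assumption, subst generate, rule UNIV_I)
  then have "x = s" using cinner_eq_zeroI [of "x - s"] by simp
  with s show ?thesis by simp
qed

lemma star_hom_has_sum:
  fixes \<Theta> :: "'a bop \<Rightarrow> 'a bop"
  assumes "\<And>i x. i \<in> I \<Longrightarrow> \<Theta> A (W i x) = W i (A x)"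
  shows "((\<lambda>i. W i (A (W' i x))) has_sum \<Theta> A x) I"
proof -
  have "((\<lambda>i. \<Theta> A (W i (W' i x))) has_sum \<Theta> A x) I"
    by (rule has_sum_bounded_linear [OF bounded_linear_bop has_sum_resolution])
  then show ?thesis by (simp add: assms cong: has_sum_cong)
qed

text \<open>For an isometry \<open>A\<close>, Pythagoras gives \<open>S A x\<close> the same squared
  norm as the resolution of \<open>x\<close>. Coisometries follow from
  \<open>adj (S A) = S (adj A)\<close>.\<close>

lemma extreme_sum:
  fixes S :: "'a bop \<Rightarrow> 'a bop"
  assumes S: "\<And>A x. ((\<lambda>i. W i (bop_apply A (W' i x))) has_sum S A x) I" and A: "extreme A"
  shows "extreme (S A)"
proof -
  have iso: "isometry (S A)" if A: "isometry A" for A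
    unfolding isometry_def
  proof
    fix x
    have norm_sq: "((\<lambda>i. (norm (W' i x))\<^sup>2) has_sum (norm s)\<^sup>2) I"
      if "((\<lambda>i. W i (bop_apply B (W' i x))) has_sum s) I" "isometry B" for B s
    proof -
      have "((\<lambda>i. (norm (W i (B (W' i x))))\<^sup>2) has_sum (norm s)\<^sup>2) I"
        by (rule has_sum_norm_sq [OF _ that(1)]) (auto simp: pairwise_def orth)
      then show ?thesis using that(2) by (simp add: norm isometry_def cong: has_sum_cong)
    qed
    have "(norm (S A x))\<^sup>2 = (norm x)\<^sup>2"
      by (rule has_sum_unique [OF norm_sq [OF S A] norm_sq [of bop_id]])
        (simp_all add: has_sum_resolution isometry_id)
    then show "norm (S A x) = norm x" by (rule power2_eq_imp_eq) simp_all
  qed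
  have "adj (S A) = S (adj A)"
  proof (rule adj_eqI')
    fix x y
    have "((\<lambda>i. cinner (W i (A (W' i x))) y) has_sum cinner (S A x) y) I"
      by (rule has_sum_cinner_left [OF S])
    moreover have "((\<lambda>i. cinner x (W i (adj A (W' i y)))) has_sum cinner x (S (adj A) y)) I"
      by (rule has_sum_bounded_linear [OF bounded_linear_cinner_right S])
    moreover have "cinner (W i (A (W' i x))) y = cinner x (W i (adj A (W' i y)))" if "i \<in> I" for i
      using that by (simp add: cinner_W_adj cinner_adj(1))
    ultimately show "cinner (S A x) y = cinner x (S (adj A) y)"
      using has_sum_unique by (simp cong: has_sum_cong) blast
  qed
  with A iso [of A] iso [of "adj A"] show ?thesis by (auto simp: extreme_def)
qed

end

section \<open>The characterization by families of isometries and of anti-isometries\<close>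

lemma extreme_unitary_compose: "unitary V \<Longrightarrow> extreme A \<Longrightarrow> extreme (V o\<^sub>B A)"
  by (auto simp: unitary_iff extreme_def isometry_compose)

lemma preserves_extreme_points_iff: "preserves_extreme_points \<Phi> \<longleftrightarrow> preserves_extreme \<Phi>"
  by (simp add: preserves_extreme_points_def preserves_extreme_def extreme_point_iff_extreme)

lemma linear_imp_semilinear: "Vector_Spaces.linear scaleC scaleC \<Phi> \<Longrightarrow> semilinear (\<lambda>z. z) \<Phi>"
  by (simp add: Vector_Spaces.linear_iff semilinear_def)

lemma bops_isometry_family:
  fixes \<U> :: "'a::chilbert_space bop set"
  assumes "\<forall>U\<in>\<U>. isometry U"
    and "pairwise (\<lambda>U U'. orthogonal_ranges (bop_apply U) (bop_apply U')) \<U>"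
    and "ranges_generate (bop_apply ` \<U>)"
  shows "isometry_family (\<lambda>z. z) \<U> bop_apply (\<lambda>U. bop_apply (adj U))"
  using assms
  by unfold_locales
    (auto simp: semilinear_bop is_adj_adj isometry_def pairwise_def orthogonal_ranges_def
      ranges_generate_def)

lemma anti_isometries_isometry_family:
  fixes \<W> :: "('a::chilbert_space \<Rightarrow> 'a) set"
  assumes "\<forall>W\<in>\<W>. anti_isometry W" "pairwise orthogonal_ranges \<W>" "ranges_generate \<W>"
  shows "isometry_family cnj \<W> (\<lambda>W. W) anti_adj"
  using assms
  by unfold_locales
    (auto simp: is_adj_anti_adj anti_isometry_def conj_linear_eq pairwise_def orthogonal_ranges_def
      ranges_generate_def)

theorem corollary2:
  fixes \<Phi> :: "'h::chilbert_space bop \<Rightarrow> 'h bop"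
  assumes "separable_space (euclidean :: 'h topology)"
    and "infinite_cdim TYPE('h)"
    and "Vector_Spaces.linear scaleC scaleC \<Phi>"
  shows "preserves_extreme_points \<Phi> \<longleftrightarrow>
    (\<exists>(V :: 'h bop) (\<U> :: 'h bop set).
      unitary V \<and> (\<forall>U\<in>\<U>. isometry U) \<and>
      pairwise (\<lambda>U U'. orthogonal_ranges (bop_apply U) (bop_apply U')) \<U> \<and>
      ranges_generate (bop_apply ` \<U>) \<and>
      (\<forall>A. \<exists>S. has_sot_sum (\<lambda>U. bop_apply (U o\<^sub>B A o\<^sub>B adj U)) S \<U> \<and> \<Phi> A = V o\<^sub>B S)) \<or>
    (\<exists>(V :: 'h bop) (\<W> :: ('h \<Rightarrow> 'h) set).
      unitary V \<and> (\<forall>W\<in>\<W>. anti_isometry W) \<and>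
      pairwise orthogonal_ranges \<W> \<and>
      ranges_generate \<W> \<and>
      (\<forall>A. \<exists>S. has_sot_sum (\<lambda>W x. W (bop_apply (adj A) (anti_adj W x))) S \<W> \<and> \<Phi> A = V o\<^sub>B S))"
    (is "_ \<longleftrightarrow> ?linear \<or> ?conj")
proof
  assume "preserves_extreme_points \<Phi>"
  then have pres: "preserves_extreme \<Phi>" by (simp add: preserves_extreme_points_iff)
  have lin: "semilinear (\<lambda>z. z) \<Phi>" using assms(3) by (rule linear_imp_semilinear)
  obtain e :: "nat \<Rightarrow> 'h" where e: "onb e" using onb_exists [OF assms(1,2)] .
  obtain S T :: "'h bop" where pair: "cuntz_pair S T" using cuntz_pair_exists [OF e] .
  have e0: "e 0 \<noteq> 0" using onb_norm [OF e, of 0] by auto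
  have "extreme (\<Phi> S)" using pres cuntz_pairD(1) [OF pair] by (simp add: preserves_extreme_def extreme_def)
  then show "?linear \<or> ?conj" unfolding extreme_def
  proof
    assume image: "isometry (\<Phi> S)"
    obtain V \<Theta> where V: "unitary V" and \<Theta>: "star_hom (\<lambda>z. z) \<Theta>" and \<Phi>: "\<And>A. \<Phi> A = V o\<^sub>B \<Theta> A"
      by (rule idc.preserver_star_hom [OF lin pres pair image e0]) (rule that)
    obtain \<W> where \<W>: "\<And>W. W \<in> \<W> \<Longrightarrow> semilinear (\<lambda>z. z) W" "\<And>W x. W \<in> \<W> \<Longrightarrow> norm (W x) = norm x"
        "pairwise orthogonal_ranges \<W>" "ranges_generate \<W>"
      and comm: "\<And>W A x. W \<in> \<W> \<Longrightarrow> \<Theta> A (W x) = W (A x)"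
      by (rule idc.star_hom_decomposition [OF \<Theta> assms(1) e]) (rule that)
    \<comment> \<open>The decomposition yields plain functions; being linear and norm-preserving,
      they are turned back into operators.\<close>
    define \<U> where "\<U> = Bop ` \<W>"
    have Bop: "bop_apply (Bop W) = W" if "W \<in> \<W>" for W
      by (rule bop_apply_Bop [of _ 1]) (simp_all add: \<W> that)
    have image: "bop_apply ` \<U> = \<W>" by (auto simp: \<U>_def Bop image_image)
    have \<U>: "\<forall>U\<in>\<U>. isometry U" "ranges_generate (bop_apply ` \<U>)"
        "pairwise (\<lambda>U U'. orthogonal_ranges (bop_apply U) (bop_apply U')) \<U>"
      using \<W> unfolding image
      by (auto simp: \<U>_def Bop isometry_def pairwise_def)
    interpret fam: isometry_family "\<lambda>z. z" \<U> bop_apply "\<lambda>U. bop_apply (adj U)"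
      by (rule bops_isometry_family) (rule \<U>)+
    show ?thesis
    proof (intro disjI1 exI conjI allI)
      show "has_sot_sum (\<lambda>U. bop_apply (U o\<^sub>B A o\<^sub>B adj U)) (\<Theta> A) \<U>" for A
        unfolding has_sot_sum_def bop_apply_simps
        by (intro allI fam.star_hom_has_sum) (auto simp: \<U>_def Bop comm)
    qed (rule V \<U> \<Phi>)+
  next
    assume image: "isometry (adj (\<Phi> S))"
    \<comment> \<open>Otherwise \<open>A \<mapsto> adj (\<Phi> (adj A))\<close> would send both
      \<open>S\<close> and \<open>adj S\<close> to isometries.\<close>
    have "isometry (\<Phi> (adj S))"
    proof (rule ccontr)
      assume not: "\<not> isometry (\<Phi> (adj S))"
      define \<Psi> where "\<Psi> A = adj (\<Phi> (adj A))" for A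
      have "extreme (\<Phi> (adj S))"
        using pres cuntz_pairD(1) [OF pair] by (simp add: preserves_extreme_def extreme_def)
      with not have "isometry (\<Psi> S)" by (simp add: extreme_def \<Psi>_def)
      moreover have "semilinear (\<lambda>z. z) \<Psi>"
        using lin by (simp add: \<Psi>_def semilinear_def)
      moreover have "preserves_extreme \<Psi>"
        using pres by (simp add: \<Psi>_def preserves_extreme_def)
      ultimately have "\<not> isometry (\<Psi> (adj S))"
        using idc.preserver_not_both_isometries pair e0 by metis
      with image show False by (simp add: \<Psi>_def)
    qed
    \<comment> \<open>Precomposition with \<open>adj\<close> gives a conjugate-linear preserver that
      maps \<open>S\<close> to an isometry, so the \<open>cnj\<close> case applies.\<close>
    define \<Psi> where "\<Psi> A = \<Phi> (adj A)" for A
    have "semilinear cnj \<Psi>"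
      using lin by (simp add: \<Psi>_def semilinear_def)
    moreover have "preserves_extreme \<Psi>" using pres by (simp add: \<Psi>_def preserves_extreme_def)
    moreover have "isometry (\<Psi> S)" using \<open>isometry (\<Phi> (adj S))\<close> by (simp add: \<Psi>_def)
    ultimately obtain V \<Theta> where V: "unitary V" and \<Theta>: "star_hom cnj \<Theta>"
      and \<Psi>: "\<And>A. \<Psi> A = V o\<^sub>B \<Theta> A"
      by (rule cnjc.preserver_star_hom [OF _ _ pair _ e0]) (rule that)
    obtain \<W> where \<W>: "\<And>W. W \<in> \<W> \<Longrightarrow> semilinear cnj W" "\<And>W x. W \<in> \<W> \<Longrightarrow> norm (W x) = norm x"
      and orth: "pairwise orthogonal_ranges \<W>" and generate: "ranges_generate \<W>"
      and comm: "\<And>W A x. W \<in> \<W> \<Longrightarrow> \<Theta> A (W x) = W (A x)"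
      by (rule cnjc.star_hom_decomposition [OF \<Theta> assms(1) e]) (rule that)
    have anti: "\<forall>W\<in>\<W>. anti_isometry W" using \<W> by (simp add: anti_isometry_def conj_linear_eq)
    interpret fam: isometry_family cnj \<W> "\<lambda>W. W" anti_adj
      by (rule anti_isometries_isometry_family [OF anti orth generate])
    show ?thesis
    proof (intro disjI2 exI conjI allI)
      fix A
      show "has_sot_sum (\<lambda>W x. W (bop_apply (adj A) (anti_adj W x))) (\<Theta> (adj A)) \<W>"
        unfolding has_sot_sum_def by (intro allI fam.star_hom_has_sum comm)
      show "\<Phi> A = V o\<^sub>B \<Theta> (adj A)" using \<Psi> [of "adj A"] by (simp add: \<Psi>_def)
    qed (rule V anti orth generate)+
  qed
next
  assume "?linear \<or> ?conj"
  then show "preserves_extreme_points \<Phi>"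
    unfolding preserves_extreme_points_iff preserves_extreme_def
  proof (elim disjE exE conjE)
    fix V and \<U> :: "'h bop set"
    assume V: "unitary V" and \<U>: "\<forall>U\<in>\<U>. isometry U"
      "pairwise (\<lambda>U U'. orthogonal_ranges (bop_apply U) (bop_apply U')) \<U>"
      "ranges_generate (bop_apply ` \<U>)"
      and "\<forall>A. \<exists>S. has_sot_sum (\<lambda>U. bop_apply (U o\<^sub>B A o\<^sub>B adj U)) S \<U> \<and> \<Phi> A = V o\<^sub>B S"
    then obtain S where S: "\<And>A. has_sot_sum (\<lambda>U. bop_apply (U o\<^sub>B A o\<^sub>B adj U)) (S A) \<U>"
      and \<Phi>: "\<And>A. \<Phi> A = V o\<^sub>B S A" by metis
    interpret fam: isometry_family "\<lambda>z. z" \<U> bop_apply "\<lambda>U. bop_apply (adj U)"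
      by (rule bops_isometry_family [OF \<U>])
    have "extreme (S A)" if "extreme A" for A
      by (rule fam.extreme_sum [OF _ that]) (use S in \<open>simp add: has_sot_sum_def\<close>)
    then show "\<forall>A. extreme A \<longrightarrow> extreme (\<Phi> A)"
      by (simp add: \<Phi> extreme_unitary_compose [OF V])
  next
    fix V and \<W> :: "('h \<Rightarrow> 'h) set"
    assume V: "unitary V" and \<W>: "\<forall>W\<in>\<W>. anti_isometry W" "pairwise orthogonal_ranges \<W>"
      "ranges_generate \<W>"
      and "\<forall>A. \<exists>S. has_sot_sum (\<lambda>W x. W (bop_apply (adj A) (anti_adj W x))) S \<W> \<and> \<Phi> A = V o\<^sub>B S"
    then obtain S where S: "\<And>A. has_sot_sum (\<lambda>W x. W (bop_apply (adj A) (anti_adj W x))) (S A) \<W>"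
      and \<Phi>: "\<And>A. \<Phi> A = V o\<^sub>B S A" by metis
    interpret fam: isometry_family cnj \<W> "\<lambda>W. W" anti_adj
      by (rule anti_isometries_isometry_family [OF \<W>])
    \<comment> \<open>The given sums contain \<open>adj A\<close> where \<open>extreme_sum\<close>
      has \<open>A\<close>, so it is applied to \<open>A \<mapsto> S (adj A)\<close>.\<close>
    have "extreme (S (adj A))" if "extreme A" for A
      by (rule fam.extreme_sum [where S = "\<lambda>A. S (adj A)", OF _ that])
        (use S [of "adj _"] in \<open>simp add: has_sot_sum_def\<close>)
    from this [of "adj _"] show "\<forall>A. extreme A \<longrightarrow> extreme (\<Phi> A)"
      by (simp add: \<Phi> extreme_unitary_compose [OF V])
  qed
qed

end
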